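(* Let $n\ge 2$, let $W=W(A_{2n-1})$ be the Coxeter group of type $A_{2n-1}$ with longest element $w_o$, and let $W_o\subset W$ be the subgroup of elements commuting with $w_o$. For integers $l\in\{0,\dots,n\}$ and $k\in\{0,\dots,\lfloor (n-l)/2\rfloor\}$ let $$I_{k,l}=\{2i-1 : 1\le i\le k\}\cup\{2n+1-2i : 1\le i\le k\}\cup\{j : n-l+1\le j\le n+l-1\}\subset\{1,\dots,2n-1\}$$ (the last set has $\max\{2l-1,0\}$ elements) and $c_{k,l}:=w_{I_{k,l}}$. Then each $c_{k,l}$ is an involution in $W_o$; each involution in $W_o$ is conjugate in $W_o$ to precisely one of the involutions $c_{k,l}$; and for all such $k,l$ the element $w_o c_{k,l}$ is conjugate in $W_o$ to $c_{k,\,n-2k-l}$.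
   Context: The nodes of the Coxeter graph $A_{2n-1}$ are numbered $1,\dots,2n-1$ along the path; node $i$ corresponds to the simple generator $s_i$ of $W(A_{2n-1})$. For a set of nodes $I$, $W_I$ denotes the parabolic subgroup generated by $\{s_i: i\in I\}$, and $w_I$ denotes its longest element. An involution is an element $x$ with $x^2=1$ (the identity is included). *)

theory Defs
  imports "HOL-Algebra.Algebra"
begin

text \<open>
  Coxeter groups are given by the usual presentation
  \<open>W = \<langle> s i (i \<in> I) | (s i s j)^(m i j) = 1 \<rangle>\<close>. Words are lists of indices. Since \<open>m i i = 1\<close>
  makes every generator its own inverse, positive words suffice, and the group presentation
  coincides with the monoid presentation below. The value \<open>m i j = 0\<close> encodes \<open>\<infinity>\<close>; then the
  relator is the empty word, so no relation is imposed.
\<close>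

definition coxeter_matrix :: "'i set \<Rightarrow> ('i \<Rightarrow> 'i \<Rightarrow> nat) \<Rightarrow> bool" where
  "coxeter_matrix I m \<longleftrightarrow>
     (\<forall>i\<in>I. \<forall>j\<in>I. m i j = m j i \<and> (m i j = 1 \<longleftrightarrow> i = j))"

inductive word_equiv :: "'i set \<Rightarrow> ('i \<Rightarrow> 'i \<Rightarrow> nat) \<Rightarrow> 'i list \<Rightarrow> 'i list \<Rightarrow> bool"
  for I m where
  refl: "u \<in> lists I \<Longrightarrow> word_equiv I m u u"
| sym: "word_equiv I m u v \<Longrightarrow> word_equiv I m v u"
| trans: "word_equiv I m u v \<Longrightarrow> word_equiv I m v w \<Longrightarrow> word_equiv I m u w"
| relator: "\<lbrakk>u \<in> lists I; v \<in> lists I; i \<in> I; j \<in> I\<rbrakk>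
    \<Longrightarrow> word_equiv I m (u @ concat (replicate (m i j) [i, j]) @ v) (u @ v)"

definition word_val :: "('a, 'b) monoid_scheme \<Rightarrow> ('i \<Rightarrow> 'a) \<Rightarrow> 'i list \<Rightarrow> 'a" where
  "word_val W s u = foldr (\<lambda>i x. s i \<otimes>\<^bsub>W\<^esub> x) u \<one>\<^bsub>W\<^esub>"

locale coxeter_system = group W
  for W :: "('a, 'b) monoid_scheme" (structure)
    and I :: "'i set" and m :: "'i \<Rightarrow> 'i \<Rightarrow> nat" and s :: "'i \<Rightarrow> 'a" +
  assumes matrix: "coxeter_matrix I m"
    and gen_closed: "s \<in> I \<rightarrow> carrier W"
    and gen: "generate W (s ` I) = carrier W"
    and presentation: "\<lbrakk>u \<in> lists I; v \<in> lists I\<rbrakk>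
      \<Longrightarrow> word_val W s u = word_val W s v \<longleftrightarrow> word_equiv I m u v"

definition type_A_matrix :: "nat \<Rightarrow> nat \<Rightarrow> nat" where
  "type_A_matrix i j = (if i = j then 1 else if i = Suc j \<or> j = Suc i then 3 else 2)"

definition parabolic :: "('a, 'b) monoid_scheme \<Rightarrow> ('i \<Rightarrow> 'a) \<Rightarrow> 'i set \<Rightarrow> 'a set" where
  "parabolic W s J = generate W (s ` J)"

definition cox_length :: "('a, 'b) monoid_scheme \<Rightarrow> ('i \<Rightarrow> 'a) \<Rightarrow> 'i set \<Rightarrow> 'a \<Rightarrow> nat" where
  "cox_length W s J x = (LEAST k. \<exists>u\<in>lists J. length u = k \<and> word_val W s u = x)"

text \<open>
  The longest element of \<open>W\<^sub>J\<close>, with length measured in the generators indexed by \<open>J\<close>.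
  It exists and is unique whenever \<open>W\<^sub>J\<close> is finite.
\<close>

definition longest_element :: "('a, 'b) monoid_scheme \<Rightarrow> ('i \<Rightarrow> 'a) \<Rightarrow> 'i set \<Rightarrow> 'a" where
  "longest_element W s J = (THE w. w \<in> parabolic W s J \<and>
     (\<forall>x\<in>parabolic W s J. cox_length W s J x \<le> cox_length W s J w))"

definition commuting_with :: "('a, 'b) monoid_scheme \<Rightarrow> 'a \<Rightarrow> 'a set" where
  "commuting_with W z = {x \<in> carrier W. x \<otimes>\<^bsub>W\<^esub> z = z \<otimes>\<^bsub>W\<^esub> x}"

definition involutions :: "('a, 'b) monoid_scheme \<Rightarrow> 'a set" where
  "involutions W = {x \<in> carrier W. x \<otimes>\<^bsub>W\<^esub> x = \<one>\<^bsub>W\<^esub>}"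

definition conjugate_in :: "('a, 'b) monoid_scheme \<Rightarrow> 'a set \<Rightarrow> 'a \<Rightarrow> 'a \<Rightarrow> bool" where
  "conjugate_in W H x y \<longleftrightarrow> (\<exists>g\<in>H. y = g \<otimes>\<^bsub>W\<^esub> x \<otimes>\<^bsub>W\<^esub> inv\<^bsub>W\<^esub> g)"

definition kl_pairs :: "nat \<Rightarrow> (nat \<times> nat) set" where
  "kl_pairs n = {(k, l). l \<le> n \<and> k \<le> (n - l) div 2}"

text \<open>
  For \<open>(k, l) \<in> kl_pairs n\<close> and \<open>n \<ge> 1\<close> no subtraction below is truncated.
\<close>

definition nodes_kl :: "nat \<Rightarrow> nat \<Rightarrow> nat \<Rightarrow> nat set" where
  "nodes_kl n k l = {2 * i - 1 | i. 1 \<le> i \<and> i \<le> k}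
     \<union> {2 * n + 1 - 2 * i | i. 1 \<le> i \<and> i \<le> k}
     \<union> {n - l + 1 .. n + l - 1}"

end

(*
  By Matsumoto's argument the word problem of W is that of the symmetric group on {1..2n}, so W is
  anti-isomorphic to that group. The length of a permutation in a parabolic subgroup is its number
  of inversions, and the longest element of the subgroup is the only block-preserving permutation
  that is decreasing on every block. Hence w_o is the reversal r, and the involutions in W_o are the
  permutations x with x^2 = 1 that commute with r. Such an x makes {1..2n} a set with an action of
  the Klein four-group <x, r> in which r acts freely. The action is determined up to isomorphism by
  the numbers of points with x a = a and with x a = r a; for c_{k,l} they are 2(n - l - 2k) and 2l,
  and multiplication by r exchanges them.
*)

theory Submission
  imports Defs
begin

section \<open>Inversions and block-preserving permutations\<close>

text \<open>As \<open>r\<close> acts freely, every orbit has two or four points: \<open>x\<close>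
  acts on it as the identity, or as \<open>r\<close>, or the orbit is regular. With f, l and k
  orbits of these three kinds, 2n = 2f + 2l + 4k. So l + 2k <= n, which is exactly the range of
  \<open>kl_pairs\<close>, and f = n - l - 2k is determined; exchanging f and l produces the index n
  - 2k - l. Conjugacy in W_o amounts to a bijection that commutes with \<open>r\<close> and
  intertwines the two involutions, so it can be built orbit by orbit. The group is known only
  through equivalence of words. That relators act trivially gives a map to permutations; its
  injectivity is the hard half and needs a comparison of reduced words. Moreover
  \<open>longest_element\<close> is a definite description, with length measured in the generators
  of \<open>J\<close> alone, so reduced words must be found inside \<open>J\<close> and the element
  of maximal length must be shown to be unique.\<close>

abbreviation adj :: "nat \<Rightarrow> nat \<Rightarrow> nat" where
  "adj i \<equiv> transpose i (Suc i)"

text \<open>Letters act on positions: putting \<open>i\<close> in front of a word swaps two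
  neighbours in the list of values \<open>p 1, ..., p N\<close>. The number of inversions then
  changes by one at each Cons, at the price that products are reversed.\<close>

fun word_perm :: "nat list \<Rightarrow> nat \<Rightarrow> nat" where
  "word_perm [] = id"
| "word_perm (i # u) = word_perm u \<circ> adj i"

definition inversions :: "nat \<Rightarrow> (nat \<Rightarrow> nat) \<Rightarrow> (nat \<times> nat) set" where
  "inversions N p = {(a, b). 1 \<le> a \<and> a < b \<and> b \<le> N \<and> p b < p a}"

text \<open>Node \<open>j\<close> is the edge between the points \<open>j\<close> and
  \<open>Suc j\<close>. The blocks are the connected components of the points under the edges in
  \<open>J\<close>, and the half-open interval lists the edges between the two points.\<close>

definition same_block :: "nat set \<Rightarrow> nat \<Rightarrow> nat \<Rightarrow> bool" where
  "same_block J a b \<longleftrightarrow> {min a b..<max a b} \<subseteq> J"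

definition block_perms :: "nat \<Rightarrow> nat set \<Rightarrow> (nat \<Rightarrow> nat) set" where
  "block_perms N J = {p. p permutes {1..N} \<and> (\<forall>a. same_block J (p a) a)}"

lemma adj_permutes: "i \<in> {1..<N} \<Longrightarrow> adj i permutes {1..N}"
  by (rule permutes_swap_id) auto

lemma comp_adj_adj [simp]: "p \<circ> adj i \<circ> adj i = p"
  by (simp add: comp_assoc)

lemma adj_commute: "i \<noteq> j \<Longrightarrow> i \<noteq> Suc j \<Longrightarrow> j \<noteq> Suc i \<Longrightarrow> adj i \<circ> adj j = adj j \<circ> adj i"
  by (auto simp: fun_eq_iff transpose_def)

lemma adj_braid: "adj i \<circ> adj (Suc i) \<circ> adj i = adj (Suc i) \<circ> adj i \<circ> adj (Suc i)"
  by (auto simp: fun_eq_iff transpose_def)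

lemma word_perm_append: "word_perm (u @ v) = word_perm v \<circ> word_perm u"
  by (induction u) (simp_all add: comp_assoc)

lemma word_perm_permutes: "u \<in> lists {1..<N} \<Longrightarrow> word_perm u permutes {1..N}"
proof (induction u)
  case (Cons i u)
  then have "i \<in> {1..<N}" and u: "word_perm u permutes {1..N}"
    by simp_all
  then have "adj i permutes {1..N}"
    by (intro adj_permutes)
  with u show "word_perm (i # u) permutes {1..N}"
    using permutes_compose by simp
next
  show "word_perm [] permutes {1..N}"
    by (simp add: permutes_id)
qed

lemma inversions_id [simp]: "inversions N id = {}"
  by (auto simp: inversions_def)

lemma finite_inversions: "finite (inversions N p)"
  by (rule finite_subset[of _ "{1..N} \<times> {1..N}"]) (auto simp: inversions_def)

text \<open>\<open>adj j\<close> preserves the order of any two positions other than the pair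
  \<open>j\<close>, \<open>Suc j\<close>. Hence it matches the inversions of both permutations, and
  only \<open>(j, Suc j)\<close> is left over.\<close>

lemma card_inversions_descent:
  assumes j: "j \<in> {1..<N}" and d: "p (Suc j) < p j"
  shows "card (inversions N p) = Suc (card (inversions N (p \<circ> adj j)))"
proof -
  let ?f = "\<lambda>(a, b). (adj j a, adj j b)"
  have "bij_betw ?f (inversions N (p \<circ> adj j)) (inversions N p - {(j, Suc j)})"
    by (rule bij_betw_byWitness[where f' = ?f])
      (use j d in \<open>auto simp: inversions_def transpose_def split: if_splits\<close>)
  then have "card (inversions N (p \<circ> adj j)) = card (inversions N p - {(j, Suc j)})"
    by (rule bij_betw_same_card)
  moreover have "(j, Suc j) \<in> inversions N p"
    using j d by (auto simp: inversions_def)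
  ultimately show ?thesis
    using card.remove[OF finite_inversions] by metis
qed

lemma card_inversions_ascent:
  assumes j: "j \<in> {1..<N}" and p: "inj p" and d: "\<not> p (Suc j) < p j"
  shows "card (inversions N (p \<circ> adj j)) = Suc (card (inversions N p))"
proof -
  have "p j \<noteq> p (Suc j)"
    using p by (simp add: inj_eq)
  then show ?thesis
    using card_inversions_descent[OF j, of "p \<circ> adj j"] d by simp
qed

lemma card_inversions_word_perm:
  "u \<in> lists {1..<N} \<Longrightarrow> card (inversions N (word_perm u)) \<le> length u"
proof (induction u)
  show "card (inversions N (word_perm [])) \<le> length []"
    by simp
next
  case (Cons i u)
  then have i: "i \<in> {1..<N}" and inj: "inj (word_perm u)"
    using permutes_inj word_perm_permutes by (auto simp del: atLeastLessThan_iff)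
  have "card (inversions N (word_perm u)) \<le> length u"
    using Cons by simp
  then show "card (inversions N (word_perm (i # u))) \<le> length (i # u)"
    using card_inversions_descent[OF i, of "word_perm u"] card_inversions_ascent[OF i inj]
    by (cases "word_perm u (Suc i) < word_perm u i") simp_all
qed

section \<open>Blocks of points and the permutations that preserve them\<close>

lemma same_block_sym: "same_block J a b = same_block J b a"
  by (simp add: same_block_def min.commute max.commute)

lemma same_block_refl: "same_block J a a"
  by (simp add: same_block_def)

lemma same_block_trans:
  assumes "same_block J a b" "same_block J b c" shows "same_block J a c"
proof -
  have "{min a c..<max a c} \<subseteq> {min a b..<max a b} \<union> {min b c..<max b c}"
    by auto
  with assms show ?thesis by (auto simp: same_block_def)
qed

lemma same_block_adj: "j \<in> J \<Longrightarrow> same_block J (adj j a) a"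
  by (auto simp: same_block_def transpose_def)

lemma block_perms_comp: "p \<in> block_perms N J \<Longrightarrow> q \<in> block_perms N J \<Longrightarrow> p \<circ> q \<in> block_perms N J"
  unfolding block_perms_def by (auto intro: permutes_compose same_block_trans)

lemma block_perms_inv:
  assumes "p \<in> block_perms N J" shows "inv_into UNIV p \<in> block_perms N J"
  using assms unfolding block_perms_def
  by (auto intro: permutes_inv) (metis permutes_inverses(1) same_block_sym)

lemma adj_block_perms: "J \<subseteq> {1..<N} \<Longrightarrow> j \<in> J \<Longrightarrow> adj j \<in> block_perms N J"
  unfolding block_perms_def using adj_permutes same_block_adj by blast

lemma block_perms_full: "block_perms N {1..<N} = {p. p permutes {1..N}}"
proof -
  have "same_block {1..<N} (p a) a" if "p permutes {1..N}" for p a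
  proof (cases "a \<in> {1..N}")
    case True
    then have "p a \<in> {1..N}" using permutes_in_image[OF that] by simp
    with True show ?thesis by (auto simp: same_block_def)
  next
    case False
    then show ?thesis using permutes_not_in[OF that] by (simp add: same_block_def)
  qed
  then show ?thesis by (auto simp: block_perms_def)
qed

lemma word_perm_block_perms:
  assumes "J \<subseteq> {1..<N}" shows "u \<in> lists J \<Longrightarrow> word_perm u \<in> block_perms N J"
proof (induction u)
  show "word_perm [] \<in> block_perms N J"
    by (simp add: block_perms_def same_block_refl permutes_id)
next
  case (Cons i u)
  then show "word_perm (i # u) \<in> block_perms N J"
    using block_perms_comp adj_block_perms[OF assms] by simp
qed

lemma same_block_mono_chain:
  fixes p :: "nat \<Rightarrow> nat"
  assumes asc: "\<And>j. j \<in> J \<Longrightarrow> p j < p (Suc j)" and "a < b" "same_block J a b"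
  shows "p a < p b"
proof -
  have J: "{a..<b} \<subseteq> J" using assms by (simp add: same_block_def)
  have "Suc a \<le> b" using assms by simp
  then show ?thesis using J
  proof (induction b rule: dec_induct)
    case base
    then show ?case using asc by auto
  next
    case (step m)
    then have "{a..<m} \<subseteq> J" "m \<in> J" by auto
    then have "p a < p m" "p m < p (Suc m)" using step asc by auto
    then show ?case by simp
  qed
qed

lemma same_block_anti_chain:
  fixes p :: "nat \<Rightarrow> nat"
  assumes desc: "\<And>j. j \<in> J \<Longrightarrow> p (Suc j) < p j" and "a < b" "same_block J a b"
  shows "p b < p a"
proof -
  have J: "{a..<b} \<subseteq> J" using assms by (simp add: same_block_def)
  have "Suc a \<le> b" using assms by simp
  then show ?thesis using J
  proof (induction b rule: dec_induct)
    case base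
    then show ?case using desc by auto
  next
    case (step m)
    then have "{a..<m} \<subseteq> J" "m \<in> J" by auto
    then have "p m < p a" "p (Suc m) < p m" using step desc by auto
    then show ?case by simp
  qed
qed

text \<open>By strong induction all points below \<open>i\<close> are fixed, so \<open>p i\<close>
  and the preimage \<open>k\<close> of \<open>i\<close> are at least \<open>i\<close>. If
  \<open>k\<close> were larger, it would share a block with \<open>i = p k\<close>, and monotonicity
  on that block would give \<open>p i < i\<close>.\<close>

lemma block_perms_no_descent:
  assumes p: "p \<in> block_perms N J" and asc: "\<And>j. j \<in> J \<Longrightarrow> \<not> p (Suc j) < p j"
  shows "p = id"
proof
  have perm: "p permutes {1..N}" and blk: "\<And>a. same_block J (p a) a"
    using p by (auto simp: block_perms_def)
  have inj: "p a = p b \<longleftrightarrow> a = b" for a b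
    using permutes_inj[OF perm] by (simp add: inj_eq)
  have asc': "p j < p (Suc j)" if "j \<in> J" for j
    using asc[OF that] inj[of j "Suc j"] by simp
  fix i show "p i = id i"
  proof (induction i rule: less_induct)
    case (less i)
    have ge: "i \<le> p i"
    proof (rule ccontr)
      assume "\<not> i \<le> p i"
      then show False using less[of "p i"] inj[of "p i" i] by simp
    qed
    obtain k where k: "p k = i" using permutes_surj[OF perm] by (metis surj_def)
    show ?case
    proof (cases "i < k")
      case True
      then have "p i < p k"
        using same_block_mono_chain[of J p, OF asc'] blk[of k] k by auto
      then show ?thesis using k ge by simp
    next
      case False
      then show ?thesis using less k by (metis id_apply not_less_iff_gr_or_eq)
    qed
  qed
qed

text \<open>Bubble sort with swaps from \<open>J\<close>: each descent yields a letter and removes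
  one inversion, and without a descent in \<open>J\<close> only the identity is left. Since the word
  stays inside \<open>J\<close>, length can later be measured in the generators of \<open>J\<close>
  alone.\<close>

lemma exists_reduced_word:
  assumes J: "J \<subseteq> {1..<N}"
  shows "p \<in> block_perms N J \<Longrightarrow>
    \<exists>u\<in>lists J. word_perm u = p \<and> length u = card (inversions N p)"
proof (induction "card (inversions N p)" arbitrary: p rule: less_induct)
  case less
  show ?case
  proof (cases "\<exists>j\<in>J. p (Suc j) < p j")
    case False
    then have "p = id" using block_perms_no_descent[OF less.prems] by blast
    then show ?thesis using inversions_id word_perm.simps(1) by (metis card.empty list.size(3) lists.Nil)
  next
    case True
    then obtain j where j: "j \<in> J" "p (Suc j) < p j" by blast
    then have c: "card (inversions N p) = Suc (card (inversions N (p \<circ> adj j)))"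
      using card_inversions_descent J by blast
    moreover have "p \<circ> adj j \<in> block_perms N J"
      using less.prems adj_block_perms[OF J j(1)] block_perms_comp by blast
    ultimately obtain u where "u \<in> lists J" "word_perm u = p \<circ> adj j"
      "length u = card (inversions N (p \<circ> adj j))"
      using less.hyps by (metis lessI)
    then show ?thesis using c j by (intro bexI[of _ "j # u"]) auto
  qed
qed

text \<open>Every inversion of a block-preserving permutation lies inside one block: a missing node
  \<open>c\<close> with \<open>a <= c < b\<close> is a wall that no point crosses, so
  \<open>p a <= c < p b\<close>. Inside a block \<open>w\<close> inverts every pair.\<close>

lemma reversing_block_perm_max:
  assumes w: "w \<in> block_perms N J" and desc: "\<And>j. j \<in> J \<Longrightarrow> w (Suc j) < w j"
    and p: "p \<in> block_perms N J"
  shows "inversions N p \<subseteq> inversions N w"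
proof clarify
  fix a b assume ab: "(a, b) \<in> inversions N p"
  then have lt: "a < b" "p b < p a" by (auto simp: inversions_def)
  have blk: "same_block J (p a) a" "same_block J (p b) b"
    using p by (auto simp: block_perms_def)
  have "same_block J a b"
  proof (rule ccontr)
    assume "\<not> same_block J a b"
    then obtain c where c: "a \<le> c" "c < b" "c \<notin> J" using lt by (fastforce simp: same_block_def)
    have "p a \<le> c"
    proof (rule ccontr)
      assume "\<not> p a \<le> c"
      then have "c \<in> {min (p a) a..<max (p a) a}" using c by auto
      then show False using blk(1) c(3) unfolding same_block_def by blast
    qed
    moreover have "c < p b"
    proof (rule ccontr)
      assume "\<not> c < p b"
      then have "c \<in> {min (p b) b..<max (p b) b}" using c by auto
      then show False using blk(2) c(3) unfolding same_block_def by blast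
    qed
    ultimately show False using lt by simp
  qed
  then have "w b < w a" using same_block_anti_chain[of J w, OF desc] lt by blast
  then show "(a, b) \<in> inversions N w" using ab by (auto simp: inversions_def)
qed

text \<open>Both permutations decrease on each block, so the inverse of \<open>w\<close> composed
  with \<open>p\<close> has no descent in \<open>J\<close> and is the identity.\<close>

lemma reversing_block_perm_unique:
  assumes J: "J \<subseteq> {1..<N}"
    and w: "w \<in> block_perms N J" and dw: "\<And>j. j \<in> J \<Longrightarrow> w (Suc j) < w j"
    and p: "p \<in> block_perms N J" and dp: "\<And>j. j \<in> J \<Longrightarrow> p (Suc j) < p j"
  shows "p = w"
proof -
  have ww: "w (inv_into UNIV w a) = a" for a
    using w permutes_inverses(1) by (auto simp: block_perms_def)
  have blk: "inv_into UNIV w \<circ> p \<in> block_perms N J"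
    using block_perms_comp[OF block_perms_inv[OF w] p] .
  have "inv_into UNIV w \<circ> p = id"
  proof (rule block_perms_no_descent[OF blk])
    fix j assume j: "j \<in> J"
    let ?a = "(inv_into UNIV w \<circ> p) j" and ?b = "(inv_into UNIV w \<circ> p) (Suc j)"
    have "same_block J ?a j" "same_block J ?b (Suc j)"
      using blk by (auto simp: block_perms_def)
    moreover have "same_block J j (Suc j)" using j by (auto simp: same_block_def)
    ultimately have "same_block J ?b ?a" by (meson same_block_sym same_block_trans)
    then show "\<not> ?b < ?a"
      using same_block_anti_chain[of J w ?b ?a, OF dw] dp[OF j] by (auto simp: ww)
  qed
  then show ?thesis using ww by (metis comp_apply ext id_apply)
qed

section \<open>The word problem in type A\<close>

locale coxeter_type_A = coxeter_system W "{1..<N}" type_A_matrix s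
  for W :: "('a, 'b) monoid_scheme" (structure) and N :: nat and s :: "nat \<Rightarrow> 'a"
begin

lemma gen_in_carrier [simp]: "i \<in> {1..<N} \<Longrightarrow> s i \<in> carrier W"
  using gen_closed by blast

lemma word_val_Nil [simp]: "word_val W s [] = \<one>"
  and word_val_Cons [simp]: "word_val W s (i # u) = s i \<otimes> word_val W s u"
  by (simp_all add: word_val_def)

lemma word_val_closed [simp]: "u \<in> lists {1..<N} \<Longrightarrow> word_val W s u \<in> carrier W"
  by (induction u) (simp_all del: One_nat_def atLeastLessThan_iff)

lemma word_val_append:
  "u \<in> lists {1..<N} \<Longrightarrow> v \<in> lists {1..<N} \<Longrightarrow>
    word_val W s (u @ v) = word_val W s u \<otimes> word_val W s v"
  by (induction u) (simp_all add: m_assoc del: One_nat_def atLeastLessThan_iff)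

section \<open>The Coxeter relations in the group and among adjacent transpositions\<close>

lemma relator_val:
  assumes "i \<in> {1..<N}" "j \<in> {1..<N}"
  shows "word_val W s (concat (replicate (type_A_matrix i j) [i, j])) = \<one>"
proof -
  let ?r = "concat (replicate (type_A_matrix i j) [i, j])"
  have "word_equiv {1..<N} type_A_matrix ([] @ ?r @ []) ([] @ [])"
    using assms by (intro word_equiv.relator) auto
  moreover have "?r \<in> lists {1..<N}"
    using assms by (auto simp: set_replicate_conv_if split: if_splits)
  ultimately show ?thesis
    using presentation[of ?r "[]"] by simp
qed

lemma gen_square: "i \<in> {1..<N} \<Longrightarrow> s i \<otimes> s i = \<one>"
  using relator_val[of i i] by (simp add: type_A_matrix_def)

lemma gen_gen_cancel: "i \<in> {1..<N} \<Longrightarrow> x \<in> carrier W \<Longrightarrow> s i \<otimes> (s i \<otimes> x) = x"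
  by (simp add: m_assoc[symmetric] gen_square del: One_nat_def atLeastLessThan_iff)

text \<open>The trailing \<open>x\<close> gives the relation the right-nested shape in which
  \<open>word_val\<close> unfolds a word that continues after these letters.\<close>

lemma gen_commute:
  assumes ij: "i \<in> {1..<N}" "j \<in> {1..<N}" and far: "i \<noteq> j" "i \<noteq> Suc j" "j \<noteq> Suc i"
    and x: "x \<in> carrier W"
  shows "s i \<otimes> (s j \<otimes> x) = s j \<otimes> (s i \<otimes> x)"
proof -
  have "s i \<otimes> (s j \<otimes> (s i \<otimes> s j)) = \<one>"
    using relator_val[OF ij] far ij
    by (simp add: type_A_matrix_def numeral_2_eq_2 del: One_nat_def atLeastLessThan_iff)
  then have "s j \<otimes> (s i \<otimes> s j) = s i"
    using gen_gen_cancel[OF ij(1), of "s j \<otimes> (s i \<otimes> s j)"] ij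
    by (simp del: One_nat_def atLeastLessThan_iff)
  then have "s i \<otimes> s j = s j \<otimes> s i"
    using gen_gen_cancel[OF ij(2), of "s i \<otimes> s j"] ij
    by (simp del: One_nat_def atLeastLessThan_iff)
  then show ?thesis
    using ij x by (simp add: m_assoc[symmetric] del: One_nat_def atLeastLessThan_iff)
qed

lemma gen_braid:
  assumes ij: "i \<in> {1..<N}" "Suc i \<in> {1..<N}" and x: "x \<in> carrier W"
  shows "s i \<otimes> (s (Suc i) \<otimes> (s i \<otimes> x)) = s (Suc i) \<otimes> (s i \<otimes> (s (Suc i) \<otimes> x))"
proof -
  define a b where "a = s i" and "b = s (Suc i)"
  have [simp]: "a \<in> carrier W" "b \<in> carrier W"
    using ij unfolding a_def b_def by (simp_all del: One_nat_def atLeastLessThan_iff)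
  have aa: "a \<otimes> (a \<otimes> y) = y" and bb: "b \<otimes> (b \<otimes> y) = y" if "y \<in> carrier W" for y
    using that ij gen_gen_cancel unfolding a_def b_def by blast+
  have "a \<otimes> (b \<otimes> (a \<otimes> (b \<otimes> (a \<otimes> b)))) = \<one>"
    using relator_val[OF ij] ij
    by (simp add: type_A_matrix_def numeral_3_eq_3 a_def b_def del: One_nat_def atLeastLessThan_iff)
  then have "b \<otimes> (a \<otimes> (b \<otimes> (a \<otimes> b))) = a"
    using aa[of "b \<otimes> (a \<otimes> (b \<otimes> (a \<otimes> b)))"] by simp
  then have "a \<otimes> (b \<otimes> (a \<otimes> b)) = b \<otimes> a"
    using bb[of "a \<otimes> (b \<otimes> (a \<otimes> b))"] by simp
  then have "b \<otimes> (a \<otimes> b) = a \<otimes> (b \<otimes> a)"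
    using aa[of "b \<otimes> (a \<otimes> b)"] by simp
  then have "a \<otimes> (b \<otimes> a) \<otimes> x = b \<otimes> (a \<otimes> b) \<otimes> x" by simp
  then have "a \<otimes> (b \<otimes> (a \<otimes> x)) = b \<otimes> (a \<otimes> (b \<otimes> x))"
    using x by (simp add: m_assoc)
  then show ?thesis by (simp add: a_def b_def)
qed

lemma word_perm_relator: "word_perm (concat (replicate (type_A_matrix i j) [i, j])) = id"
proof -
  have far: "word_perm [i, j, i, j] = id" if "i \<noteq> j" "i \<noteq> Suc j" "j \<noteq> Suc i" for i j
  proof -
    have "word_perm [i, j, i, j] = adj j \<circ> (adj i \<circ> adj j) \<circ> adj i"
      by (simp add: comp_assoc)
    also have "\<dots> = adj j \<circ> (adj j \<circ> adj i) \<circ> adj i"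
      by (simp only: adj_commute[OF that])
    also have "\<dots> = id"
      by (simp add: comp_assoc[symmetric])
    finally show ?thesis .
  qed
  have braid: "adj a \<circ> adj b \<circ> adj a \<circ> adj b \<circ> adj a \<circ> adj b = id"
    if "a = Suc b \<or> b = Suc a" for a b
  proof -
    have "adj a \<circ> adj b \<circ> adj a = adj b \<circ> adj a \<circ> adj b"
      using that adj_braid[of a] adj_braid[of b] by auto
    then show ?thesis by (simp add: comp_assoc[symmetric])
  qed
  consider "i = j" | "i = Suc j \<or> j = Suc i" | "i \<noteq> j" "i \<noteq> Suc j" "j \<noteq> Suc i" by blast
  then show ?thesis
  proof cases
    case 1
    then show ?thesis by (simp add: type_A_matrix_def)
  next
    case 2
    then show ?thesis
      using braid[of j i] by (auto simp add: type_A_matrix_def numeral_3_eq_3)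
  next
    case 3
    then show ?thesis
      using far[of i j] by (simp add: type_A_matrix_def numeral_2_eq_2)
  qed
qed

lemma word_equiv_word_perm:
  "word_equiv {1..<N} type_A_matrix u v \<Longrightarrow> word_perm u = word_perm v"
  by (induction rule: word_equiv.induct)
    (simp_all only: word_perm_append word_perm_relator comp_id)

text \<open>If \<open>i\<close> were an ascent of the whole permutation, the permutation of the tail
  would have more inversions than the tail has letters.\<close>

lemma reduced_word_Cons:
  assumes u: "i # u \<in> lists {1..<N}" and red: "length (i # u) = card (inversions N (word_perm (i # u)))"
  shows "word_perm (i # u) (Suc i) < word_perm (i # u) i"
    and "word_perm u = word_perm (i # u) \<circ> adj i"
    and "length u = card (inversions N (word_perm u))"
proof -
  let ?p = "word_perm (i # u)"
  have i: "i \<in> {1..<N}" using u by auto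
  have le: "card (inversions N (word_perm u)) \<le> length u"
    using card_inversions_word_perm u by auto
  have inj: "inj ?p" using permutes_inj[OF word_perm_permutes[OF u]] .
  show eq: "word_perm u = ?p \<circ> adj i" by simp
  show d: "?p (Suc i) < ?p i"
    using card_inversions_ascent[OF i inj] le red unfolding eq by fastforce
  show "length u = card (inversions N (word_perm u))"
    using card_inversions_descent[OF i d] red by (simp only: eq[symmetric]) simp
qed

text \<open>
  Matsumoto's argument: if \<open>i\<close> and \<open>j\<close> are descents of the same permutation, it has reduced words
  beginning with the two sides of the braid relation between \<open>s i\<close> and \<open>s j\<close>.
\<close>

lemma reduced_word_val_unique:
  assumes "u \<in> lists {1..<N}" "v \<in> lists {1..<N}" "word_perm u = word_perm v"
    and "length u = card (inversions N (word_perm u))" "length v = length u"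
  shows "word_val W s u = word_val W s v"
  using assms
proof (induction "length u" arbitrary: u v rule: less_induct)
  case less
  show ?case
  proof (cases u)
    case Nil
    then show ?thesis using less.prems by simp
  next
    case (Cons i u')
    then obtain j v' where v: "v = j # v'" using less.prems by (cases v) auto
    define p where "p = word_perm u"
    have perm: "p permutes {1..N}"
      using word_perm_permutes less.prems unfolding p_def by blast
    have i: "i \<in> {1..<N}" and j: "j \<in> {1..<N}" and u': "u' \<in> lists {1..<N}" and v': "v' \<in> lists {1..<N}"
      using less.prems Cons v by auto
    have di: "p (Suc i) < p i" and pu: "word_perm u' = p \<circ> adj i"
      and lu: "length u' = card (inversions N (p \<circ> adj i))"
      using reduced_word_Cons[of i u'] less.prems Cons unfolding p_def by metis+
    have dj: "p (Suc j) < p j" and pv: "word_perm v' = p \<circ> adj j"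
      and lv: "length v' = card (inversions N (p \<circ> adj j))"
      using reduced_word_Cons[of j v'] less.prems v unfolding p_def by metis+
    have IH: "word_val W s a = word_val W s b"
      if "a \<in> lists {1..<N}" "b \<in> lists {1..<N}" "word_perm a = q" "word_perm b = q"
        "length a = card (inversions N q)" "length b = length a" "length a = length u'" for a b q
      using less.hyps[of a b] that Cons by simp
    have reduced: "\<exists>t\<in>lists {1..<N}. word_perm t = q \<and> length t = card (inversions N q)"
      if "q permutes {1..N}" for q
      using exists_reduced_word[of "{1..<N}" N q] that block_perms_full by blast
    have desc: "card (inversions N q) = Suc (card (inversions N (q \<circ> adj a)))"
      if "q (Suc a) < q a" "a \<in> {1..<N}" for q a
      using card_inversions_descent that by blast
    have len: "length v' = length u'" using less.prems Cons v by simp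
    have perm_adj: "q \<circ> adj a permutes {1..N}" if "q permutes {1..N}" "a \<in> {1..<N}" for q a
      using permutes_compose adj_permutes that by blast
    have braid_case: "word_val W s (a # x) = word_val W s (b # y)"
      if b: "b = Suc a" and ab: "a \<in> {1..<N}" "b \<in> {1..<N}"
        and d: "p (Suc a) < p a" "p (Suc b) < p b"
        and x: "x \<in> lists {1..<N}" "word_perm x = p \<circ> adj a" "length x = length u'"
          "length x = card (inversions N (p \<circ> adj a))"
        and y: "y \<in> lists {1..<N}" "word_perm y = p \<circ> adj b" "length y = length u'"
          "length y = card (inversions N (p \<circ> adj b))"
      for a b x y
    proof -
      \<comment> \<open>\<open>p\<close> decreases along \<open>a\<close>, \<open>b\<close>,
        \<open>Suc b\<close>, and \<open>?q\<close> has these three values sorted. For a reduced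
        word \<open>t\<close> of \<open>?q\<close>, the words \<open>b # a # t\<close> and
        \<open>a # b # t\<close> are reduced words of the permutations of \<open>x\<close> and
        \<open>y\<close>. Induction applies to both, and only the braid relation remains.\<close>
      let ?q = "p \<circ> adj a \<circ> adj b \<circ> adj a"
      have q: "?q = p \<circ> adj b \<circ> adj a \<circ> adj b"
        using adj_braid[of a] unfolding b by (simp add: comp_assoc)
      obtain t where t: "t \<in> lists {1..<N}" "word_perm t = ?q" "length t = card (inversions N ?q)"
        using reduced perm_adj perm ab by meson
      have "(p \<circ> adj a) (Suc b) < (p \<circ> adj a) b" "(p \<circ> adj a \<circ> adj b) (Suc a) < (p \<circ> adj a \<circ> adj b) a"
        using d unfolding b by (auto simp: transpose_def)
      then have l: "card (inversions N (p \<circ> adj a)) = Suc (Suc (length t))"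
        using desc ab t(3) by metis
      have "word_val W s x = word_val W s (b # a # t)"
        using IH[of x "b # a # t" "p \<circ> adj a"] x l t ab by simp
      moreover have "word_val W s y = word_val W s (a # b # t)"
        using IH[of y "a # b # t" "p \<circ> adj b"] y x l t(1) t(2)[unfolded q] ab by simp
      ultimately show ?thesis
        using gen_braid[of a "word_val W s t"] ab t unfolding b by simp
    qed
    consider "i = j" | "j = Suc i" | "i = Suc j" | "i \<noteq> j" "i \<noteq> Suc j" "j \<noteq> Suc i" by blast
    then have "word_val W s (i # u') = word_val W s (j # v')"
    proof cases
      case 1
      then show ?thesis using IH[of u' v' "p \<circ> adj i"] u' v' pu pv lu len by simp
    next
      case 2
      show ?thesis by (rule braid_case) (use 2 i j di dj u' v' pu pv lu lv len in auto)
    next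
      case 3
      show ?thesis
        by (rule braid_case[symmetric]) (use 3 i j di dj u' v' pu pv lu lv len in auto)
    next
      case 4
      let ?q = "p \<circ> adj i \<circ> adj j"
      have q: "?q = p \<circ> adj j \<circ> adj i"
        using adj_commute[OF 4] by (simp add: comp_assoc)
      obtain t where t: "t \<in> lists {1..<N}" "word_perm t = ?q" "length t = card (inversions N ?q)"
        using reduced perm_adj perm i j by meson
      have "(p \<circ> adj i) (Suc j) < (p \<circ> adj i) j"
        using dj 4 by (auto simp: transpose_def)
      then have l: "card (inversions N (p \<circ> adj i)) = Suc (length t)"
        using desc j t(3) by metis
      have "word_val W s u' = word_val W s (j # t)"
        using IH[of u' "j # t" "p \<circ> adj i"] u' pu lu l t j by simp
      moreover have "word_val W s v' = word_val W s (i # t)"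
        using IH[of v' "i # t" "p \<circ> adj j"] v' pv lv len lu l t(1) t(2)[unfolded q] i by simp
      ultimately show ?thesis
        using gen_commute[OF i j 4, of "word_val W s t"] t by simp
    qed
    then show ?thesis using Cons v by simp
  qed
qed

text \<open>A letter put in front of a reduced word \<open>t\<close> keeps it reduced at an ascent.
  At a descent the permutation also has a reduced word \<open>i # r\<close>; uniqueness gives it the
  value of \<open>t\<close>, so the two copies of \<open>s i\<close> cancel and \<open>r\<close>
  remains.\<close>

lemma word_val_eq_reduced:
  "u \<in> lists {1..<N} \<Longrightarrow> \<exists>t\<in>lists {1..<N}. word_perm t = word_perm u \<and>
    length t = card (inversions N (word_perm u)) \<and> word_val W s t = word_val W s u"
proof (induction u)
  case Nil
  show "\<exists>t\<in>lists {1..<N}. word_perm t = word_perm [] \<and>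
    length t = card (inversions N (word_perm [])) \<and> word_val W s t = word_val W s []"
    by (intro bexI[of _ "[]"]) simp_all
next
  case (Cons i u)
  then have i: "i \<in> {1..<N}" and u: "u \<in> lists {1..<N}" by auto
  obtain t where t: "t \<in> lists {1..<N}" "word_perm t = word_perm u"
      "length t = card (inversions N (word_perm u))" "word_val W s t = word_val W s u"
    using Cons u by blast
  have inj: "inj (word_perm u)" using permutes_inj[OF word_perm_permutes[OF u]] .
  show "\<exists>t\<in>lists {1..<N}. word_perm t = word_perm (i # u) \<and>
    length t = card (inversions N (word_perm (i # u))) \<and> word_val W s t = word_val W s (i # u)"
  proof (cases "word_perm u (Suc i) < word_perm u i")
    case False
    then show ?thesis
      using t i card_inversions_ascent[OF i inj] by (intro bexI[of _ "i # t"]) auto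
  next
    case True
    have perm: "word_perm u \<circ> adj i permutes {1..N}"
      using permutes_compose[OF adj_permutes[OF i] word_perm_permutes[OF u]] .
    then obtain r where r: "r \<in> lists {1..<N}" "word_perm r = word_perm u \<circ> adj i"
      "length r = card (inversions N (word_perm u \<circ> adj i))"
      using exists_reduced_word[of "{1..<N}" N] block_perms_full by blast
    have "word_val W s t = word_val W s (i # r)"
      using reduced_word_val_unique[of t "i # r"] t r i card_inversions_descent[OF i True] by simp
    then have "word_val W s r = word_val W s (i # u)"
      using t(4) gen_gen_cancel[OF i, of "word_val W s r"] r by simp
    then show ?thesis using r by (intro bexI[of _ r]) auto
  qed
qed

lemma word_val_eq_iff:
  assumes "u \<in> lists {1..<N}" "v \<in> lists {1..<N}"
  shows "word_val W s u = word_val W s v \<longleftrightarrow> word_perm u = word_perm v"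
proof
  show "word_val W s u = word_val W s v \<Longrightarrow> word_perm u = word_perm v"
    using presentation[OF assms] word_equiv_word_perm by blast
next
  assume "word_perm u = word_perm v"
  then show "word_val W s u = word_val W s v"
    using word_val_eq_reduced[OF assms(1)] word_val_eq_reduced[OF assms(2)]
      reduced_word_val_unique by metis
qed

text \<open>
  \<open>word_perm\<close> reverses products, so the following is an anti-isomorphism from the symmetric group
  on \<open>{1..N}\<close> onto \<open>W\<close>; off the permutations of \<open>{1..N}\<close> its values are junk.
\<close>

definition perm_val :: "(nat \<Rightarrow> nat) \<Rightarrow> 'a" where
  "perm_val p = word_val W s (SOME u. u \<in> lists {1..<N} \<and> word_perm u = p)"

lemma perm_val_word_perm:
  assumes "u \<in> lists {1..<N}" shows "perm_val (word_perm u) = word_val W s u"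
proof -
  have "(SOME v. v \<in> lists {1..<N} \<and> word_perm v = word_perm u) \<in> lists {1..<N} \<and>
    word_perm (SOME v. v \<in> lists {1..<N} \<and> word_perm v = word_perm u) = word_perm u"
    by (rule someI[of _ u]) (use assms in blast)
  then show ?thesis using word_val_eq_iff assms unfolding perm_val_def by blast
qed

lemma exists_word:
  assumes "J \<subseteq> {1..<N}" "p \<in> block_perms N J"
  obtains u where "u \<in> lists J" "word_perm u = p" "perm_val p = word_val W s u"
    "length u = card (inversions N p)"
proof -
  obtain u where u: "u \<in> lists J" "word_perm u = p" "length u = card (inversions N p)"
    using exists_reduced_word[OF assms] by blast
  have "u \<in> lists {1..<N}"
    using u(1) assms(1) by (auto simp: in_lists_conv_set)
  then show thesis using that u perm_val_word_perm by blast
qed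

lemma exists_word_full:
  assumes "p permutes {1..N}"
  obtains u where "u \<in> lists {1..<N}" "word_perm u = p" "perm_val p = word_val W s u"
  using exists_word[of "{1..<N}" p] assms block_perms_full by blast

lemma perm_val_closed: "p permutes {1..N} \<Longrightarrow> perm_val p \<in> carrier W"
  by (metis exists_word_full word_val_closed)

lemma perm_val_mult:
  assumes "p permutes {1..N}" "q permutes {1..N}"
  shows "perm_val p \<otimes> perm_val q = perm_val (q \<circ> p)"
proof -
  obtain u v where "u \<in> lists {1..<N}" "word_perm u = p" "perm_val p = word_val W s u"
    "v \<in> lists {1..<N}" "word_perm v = q" "perm_val q = word_val W s v"
    using assms by (meson exists_word_full)
  then show ?thesis
    using perm_val_word_perm[of "u @ v"] by (simp add: word_perm_append word_val_append)
qed

lemma perm_val_id: "perm_val id = \<one>"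
  using perm_val_word_perm[of "[]"] by simp

lemma perm_val_eq_iff:
  assumes "p permutes {1..N}" "q permutes {1..N}"
  shows "perm_val p = perm_val q \<longleftrightarrow> p = q"
  using assms by (metis exists_word_full word_val_eq_iff)

section \<open>Parabolic subgroups, their length functions and longest elements\<close>

lemma generate_eq_words:
  assumes J: "J \<subseteq> {1..<N}" shows "generate W (s ` J) = word_val W s ` lists J"
proof
  have lists: "u \<in> lists {1..<N}" if "u \<in> lists J" for u
    using that J by auto
  show "word_val W s ` lists J \<subseteq> generate W (s ` J)"
  proof (rule image_subsetI)
    fix u assume "u \<in> lists J"
    then show "word_val W s u \<in> generate W (s ` J)"
      by (induction u) (auto intro: generate.one generate.eng generate.incl)
  qed
  show "generate W (s ` J) \<subseteq> word_val W s ` lists J"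
  proof
    fix x assume "x \<in> generate W (s ` J)"
    then show "x \<in> word_val W s ` lists J"
    proof induction
      case one
      show ?case by (rule image_eqI[of _ _ "[]"]) auto
    next
      case (incl h)
      then obtain j where "j \<in> J" "h = s j" by blast
      then show ?case using J by (intro image_eqI[of _ _ "[j]"]) auto
    next
      case (inv h)
      then obtain j where j: "j \<in> J" "h = s j" by blast
      then have "j \<in> {1..<N}" using J by blast
      then have "inv h = s j"
        using j gen_square inv_equality gen_in_carrier by blast
      then show ?case using j J by (intro image_eqI[of _ _ "[j]"]) auto
    next
      case (eng a b)
      then obtain u v where "u \<in> lists J" "v \<in> lists J" "a = word_val W s u" "b = word_val W s v"
        by blast
      then show ?case
        using word_val_append[OF lists lists, of u v] by (intro image_eqI[of _ _ "u @ v"]) auto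
    qed
  qed
qed

lemma parabolic_eq:
  assumes J: "J \<subseteq> {1..<N}" shows "parabolic W s J = perm_val ` block_perms N J"
proof -
  have "perm_val ` block_perms N J \<subseteq> word_val W s ` lists J"
    using exists_word[OF J] by (metis image_eqI image_subsetI)
  moreover have "word_val W s u \<in> perm_val ` block_perms N J" if "u \<in> lists J" for u
  proof -
    have "u \<in> lists {1..<N}" using that J by auto
    then show ?thesis
      using perm_val_word_perm word_perm_block_perms[OF J that] by (metis image_eqI)
  qed
  ultimately show ?thesis
    unfolding parabolic_def generate_eq_words[OF J] by blast
qed

lemma carrier_eq: "carrier W = perm_val ` {p. p permutes {1..N}}"
  using parabolic_eq[of "{1..<N}"] gen by (simp add: parabolic_def block_perms_full del: One_nat_def)

text \<open>A word over \<open>J\<close> is also a word over all nodes, so the number of inversions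
  bounds its length from below; the sorting word over \<open>J\<close> attains this bound.\<close>

lemma cox_length_perm_val:
  assumes J: "J \<subseteq> {1..<N}" and p: "p \<in> block_perms N J"
  shows "cox_length W s J (perm_val p) = card (inversions N p)"
  unfolding cox_length_def
proof (rule Least_equality)
  show "\<exists>u\<in>lists J. length u = card (inversions N p) \<and> word_val W s u = perm_val p"
    using exists_word[OF J p] by metis
next
  fix k assume "\<exists>u\<in>lists J. length u = k \<and> word_val W s u = perm_val p"
  then obtain u where u: "u \<in> lists J" "length u = k" "word_val W s u = perm_val p" by blast
  then have "u \<in> lists {1..<N}" using J by auto
  moreover from this have "word_perm u = p"
    using u p perm_val_eq_iff[OF word_perm_permutes] perm_val_word_perm
    by (simp add: block_perms_def)
  ultimately show "card (inversions N p) \<le> k"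
    using card_inversions_word_perm u by blast
qed

text \<open>An element of maximal length has its inversions among those of \<open>w\<close> and at
  least as many of them, hence the same set. It therefore descends at every node of \<open>J\<close>
  and must be \<open>w\<close>, which is the uniqueness that \<open>THE\<close> demands.\<close>

lemma longest_element_eq:
  assumes J: "J \<subseteq> {1..<N}" and w: "w \<in> block_perms N J"
    and desc: "\<And>j. j \<in> J \<Longrightarrow> w (Suc j) < w j"
  shows "longest_element W s J = perm_val w"
  unfolding longest_element_def
proof (rule the_equality)
  show "perm_val w \<in> parabolic W s J \<and>
    (\<forall>x\<in>parabolic W s J. cox_length W s J x \<le> cox_length W s J (perm_val w))"
    using reversing_block_perm_max[OF w desc] card_mono[OF finite_inversions] w
    by (auto simp: parabolic_eq[OF J] cox_length_perm_val[OF J])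
next
  fix x
  assume x: "x \<in> parabolic W s J \<and>
    (\<forall>y\<in>parabolic W s J. cox_length W s J y \<le> cox_length W s J x)"
  then obtain p where p: "p \<in> block_perms N J" "x = perm_val p"
    by (auto simp: parabolic_eq[OF J])
  have "cox_length W s J (perm_val w) \<le> cox_length W s J x"
    using x w by (auto simp: parabolic_eq[OF J])
  then have "card (inversions N w) \<le> card (inversions N p)"
    using p w by (simp add: cox_length_perm_val[OF J])
  then have eq: "inversions N p = inversions N w"
    using card_seteq[OF finite_inversions reversing_block_perm_max[OF w desc p(1)]] by blast
  have "p (Suc j) < p j" if "j \<in> J" for j
  proof -
    have "(j, Suc j) \<in> inversions N w" using desc[OF that] that J by (auto simp: inversions_def)
    then show ?thesis unfolding eq[symmetric] by (simp add: inversions_def)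
  qed
  then show "x = perm_val w"
    using reversing_block_perm_unique[OF J w desc p(1)] p by blast
qed

end

section \<open>Free involutions and the Klein four-group\<close>

definition klein_action :: "'a set \<Rightarrow> ('a \<Rightarrow> 'a) \<Rightarrow> ('a \<Rightarrow> 'a) \<Rightarrow> bool" where
  "klein_action A x r \<longleftrightarrow>
     (\<forall>a\<in>A. x a \<in> A \<and> r a \<in> A \<and> x (x a) = a \<and> r (r a) = a \<and> x (r a) = r (x a) \<and> r a \<noteq> a)"

definition klein_orbit :: "('a \<Rightarrow> 'a) \<Rightarrow> ('a \<Rightarrow> 'a) \<Rightarrow> 'a \<Rightarrow> 'a set" where
  "klein_orbit x r a = {a, r a, x a, x (r a)}"

text \<open>This records the stabilizer of \<open>a\<close>: generated by \<open>x\<close>,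
  generated by the product of \<open>x\<close> and \<open>r\<close>, or trivial. The value
  \<open>(True, True)\<close> would force \<open>r a = a\<close>, which \<open>klein_action\<close>
  excludes.\<close>

definition orbit_type :: "('a \<Rightarrow> 'a) \<Rightarrow> ('a \<Rightarrow> 'a) \<Rightarrow> 'a \<Rightarrow> bool \<times> bool" where
  "orbit_type x r a = (x a = a, x a = r a)"

lemma finite_klein_orbit [simp]: "finite (klein_orbit x r a)"
  by (simp add: klein_orbit_def)

lemma klein_orbit_subset: "klein_action A x r \<Longrightarrow> a \<in> A \<Longrightarrow> klein_orbit x r a \<subseteq> A"
  unfolding klein_action_def klein_orbit_def by blast

lemma klein_orbit_closed:
  assumes "klein_action A x r" "a \<in> A" "b \<in> klein_orbit x r a"
  shows "x b \<in> klein_orbit x r a" and "r b \<in> klein_orbit x r a"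
proof -
  have "x (x a) = a" "r (r a) = a" "x (r a) = r (x a)" "x (x (r a)) = r a" "r (r (x a)) = x a"
    using assms(1,2) unfolding klein_action_def by metis+
  then show "x b \<in> klein_orbit x r a" "r b \<in> klein_orbit x r a"
    using assms(3) unfolding klein_orbit_def by auto
qed

lemma klein_action_Diff_klein_orbit:
  assumes c: "klein_action A x r" and a: "a \<in> A"
  shows "klein_action (A - klein_orbit x r a) x r"
proof -
  have "x b \<notin> klein_orbit x r a \<and> r b \<notin> klein_orbit x r a" if "b \<in> A" "b \<notin> klein_orbit x r a" for b
    using klein_orbit_closed[OF c a] that c unfolding klein_action_def by metis
  then show ?thesis
    using c unfolding klein_action_def by blast
qed

lemma orbit_type_klein_orbit:
  assumes "klein_action A x r" "a \<in> A" "b \<in> klein_orbit x r a"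
  shows "orbit_type x r b = orbit_type x r a"
proof -
  have eqs: "x (x a) = a" "r (r a) = a" "x (r a) = r (x a)" "x (x (r a)) = r a" "r (r (x a)) = x a"
    using assms(1,2) unfolding klein_action_def by metis+
  consider "b = a" | "b = r a" | "b = x a" | "b = x (r a)"
    using assms(3) unfolding klein_orbit_def by blast
  then show ?thesis
    unfolding orbit_type_def prod.inject by cases (metis eqs)+
qed

lemma card_klein_orbit:
  assumes "klein_action A x r" "a \<in> A"
  shows "card (klein_orbit x r a) = (if x a = a \<or> x a = r a then 2 else 4)"
proof -
  have eqs: "x (x a) = a" "x (r a) = r (x a)" "x (x (r a)) = r a" "r a \<noteq> a" "r (r a) = a" "r (r (x a)) = x a"
    using assms unfolding klein_action_def by metis+
  consider "x a = a" | "x a = r a" | "x a \<noteq> a" "x a \<noteq> r a" by blast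
  then show ?thesis
  proof cases
    case 1
    then have "klein_orbit x r a = {a, r a}" using eqs by (auto simp: klein_orbit_def)
    then show ?thesis using 1 eqs by simp
  next
    case 2
    then have "klein_orbit x r a = {a, r a}" using eqs by (auto simp: klein_orbit_def)
    then show ?thesis using 2 eqs by simp
  next
    case 3
    then have "x (r a) \<noteq> a" "x (r a) \<noteq> r a" "x (r a) \<noteq> x a" using eqs by metis+
    then have "a \<notin> {r a, x a, x (r a)}" "r a \<notin> {x a, x (r a)}" "x a \<notin> {x (r a)}"
      using 3 eqs(4) by (metis insert_iff empty_iff)+
    then have "card {a, r a, x a, x (r a)} = 4"
      by (simp add: card_insert_if)
    then show ?thesis using 3 by (simp add: klein_orbit_def)
  qed
qed

section \<open>Counting orbits by type and matching them\<close>

lemma card_klein_orbit_dvd: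
  assumes "finite A" "klein_action A x r" "\<And>a. a \<in> A \<Longrightarrow> card (klein_orbit x r a) = d"
  shows "d dvd card A"
  using assms
proof (induction "card A" arbitrary: A rule: less_induct)
  case less
  show ?case
  proof (cases "A = {}")
    case False
    then obtain a where a: "a \<in> A" by blast
    have sub: "klein_orbit x r a \<subseteq> A" using klein_orbit_subset less.prems a by metis
    have "a \<in> klein_orbit x r a" by (simp add: klein_orbit_def)
    then have "card (A - klein_orbit x r a) < card A"
      using less.prems a by (intro psubset_card_mono) auto
    then have "d dvd card (A - klein_orbit x r a)"
      using less.prems(1,3)
      by (intro less.hyps klein_action_Diff_klein_orbit[OF less.prems(2) a]) auto
    moreover have "card A = card (A - klein_orbit x r a) + card (klein_orbit x r a)"
      using sub less.prems(1) by (metis card_Diff_subset card_mono finite_klein_orbit le_add_diff_inverse2)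
    ultimately show ?thesis using less.prems(3)[OF a] by simp
  qed simp
qed

lemma klein_action_type_class:
  assumes "klein_action A x r"
  shows "klein_action {a \<in> A. orbit_type x r a = T} x r"
proof -
  have "orbit_type x r (x a) = orbit_type x r a" "orbit_type x r (r a) = orbit_type x r a"
    if "a \<in> A" for a
    by (rule orbit_type_klein_orbit[OF assms that], simp add: klein_orbit_def)+
  then show ?thesis using assms unfolding klein_action_def by simp
qed

text \<open>The three possible types partition \<open>A\<close> into unions of orbits of constant
  size, namely 2, 2 and 4.\<close>

lemma card_type_classes:
  assumes fin: "finite A" and c: "klein_action A x r"
  obtains f l k where "card {a \<in> A. x a = a} = 2 * f" "card {a \<in> A. x a = r a} = 2 * l"
    "card A = 2 * f + 2 * l + 4 * k"
proof -
  let ?F = "{a \<in> A. x a = a}" and ?L = "{a \<in> A. x a = r a}"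
    and ?K = "{a \<in> A. orbit_type x r a = (False, False)}"
  have ne: "r a \<noteq> a" if "a \<in> A" for a
    using c that unfolding klein_action_def by blast
  have F: "?F = {a \<in> A. orbit_type x r a = (True, False)}"
    and L: "?L = {a \<in> A. orbit_type x r a = (False, True)}"
    using ne unfolding orbit_type_def prod.inject by metis+
  have "2 dvd card ?F"
    unfolding F by (rule card_klein_orbit_dvd[OF _ klein_action_type_class[OF c]])
      (use fin card_klein_orbit[OF c] in \<open>auto simp: orbit_type_def\<close>)
  moreover have "2 dvd card ?L"
    unfolding L by (rule card_klein_orbit_dvd[OF _ klein_action_type_class[OF c]])
      (use fin card_klein_orbit[OF c] in \<open>auto simp: orbit_type_def\<close>)
  moreover have "4 dvd card ?K"
    by (rule card_klein_orbit_dvd[OF _ klein_action_type_class[OF c]])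
      (use fin card_klein_orbit[OF c] in \<open>auto simp: orbit_type_def\<close>)
  moreover have "card A = card ?F + card ?L + card ?K"
  proof -
    have "A = ?F \<union> ?L \<union> ?K" by (auto simp: orbit_type_def)
    moreover have "card (?F \<union> ?L \<union> ?K) = card (?F \<union> ?L) + card ?K"
      by (rule card_Un_disjoint) (use fin in \<open>auto simp: orbit_type_def\<close>)
    moreover have "card (?F \<union> ?L) = card ?F + card ?L"
      by (rule card_Un_disjoint) (use fin ne in auto)
    ultimately show ?thesis by simp
  qed
  ultimately show thesis by (elim dvdE) (simp add: that)
qed

lemma klein_orbit_bij:
  assumes c: "klein_action A x r" and a: "a \<in> A"
    and c': "klein_action A' x' r'" and a': "a' \<in> A'"
    and ty: "orbit_type x r a = orbit_type x' r' a'"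
  obtains g where "bij_betw g (klein_orbit x r a) (klein_orbit x' r' a')"
    and "\<And>b. b \<in> klein_orbit x r a \<Longrightarrow> g (x b) = x' (g b) \<and> g (r b) = r' (g b)"
proof -
  have eqs: "x (x a) = a" "r (r a) = a" "x (r a) = r (x a)" "x (r (x a)) = r a" "r (r (x a)) = x a" "r a \<noteq> a"
    using c a unfolding klein_action_def by metis+
  have eqs': "x' (x' a') = a'" "r' (r' a') = a'" "x' (r' a') = r' (x' a')" "x' (r' (x' a')) = r' a'"
    "r' (r' (x' a')) = x' a'" "r' a' \<noteq> a'"
    using c' a' unfolding klein_action_def by metis+
  have iff: "x a = a \<longleftrightarrow> x' a' = a'" "x a = r a \<longleftrightarrow> x' a' = r' a'"
    using ty by (auto simp: orbit_type_def)
  \<comment> \<open>The four listed points may coincide. Equality of the types makes the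
    corresponding points of the other orbit coincide as well, so the cascade gives the intended
    value at all four.\<close>
  define g where "g = (\<lambda>b. if b = a then a' else if b = r a then r' a' else
    if b = x a then x' a' else x' (r' a'))"
  have g: "g a = a'" "g (r a) = r' a'"
    using eqs by (auto simp: g_def)
  have gx: "g (x a) = x' a'"
    using iff by (auto simp: g_def)
  have gxr: "g (x (r a)) = x' (r' a')"
  proof -
    consider "x a = a" | "x a = r a" | "x a \<noteq> a" "x a \<noteq> r a" by blast
    then show ?thesis
    proof cases
      case 1
      then show ?thesis using iff(1) g eqs(3) eqs'(3) by simp
    next
      case 2
      then show ?thesis using iff(2) g eqs eqs' by metis
    next
      case 3
      then have "x (r a) \<noteq> a" "x (r a) \<noteq> r a" "x (r a) \<noteq> x a" using eqs by metis+
      then show ?thesis by (simp add: g_def)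
    qed
  qed
  have img: "g ` klein_orbit x r a = klein_orbit x' r' a'"
    using g gx gxr by (simp add: klein_orbit_def)
  moreover have "card (klein_orbit x r a) = card (klein_orbit x' r' a')"
    unfolding card_klein_orbit[OF c a] card_klein_orbit[OF c' a'] iff ..
  ultimately have "bij_betw g (klein_orbit x r a) (klein_orbit x' r' a')"
    by (simp add: bij_betw_def eq_card_imp_inj_on)
  moreover have "g (x b) = x' (g b) \<and> g (r b) = r' (g b)" if "b \<in> klein_orbit x r a" for b
    using that g gx gxr eqs eqs' unfolding klein_orbit_def by auto
  ultimately show thesis using that by blast
qed

lemma card_type_Diff_klein_orbit:
  assumes fin: "finite A" and c: "klein_action A x r" and a: "a \<in> A"
  shows "card {b \<in> A - klein_orbit x r a. orbit_type x r b = T} =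
    card {b \<in> A. orbit_type x r b = T} - (if orbit_type x r a = T then card (klein_orbit x r a) else 0)"
proof (cases "orbit_type x r a = T")
  case True
  have "{b \<in> A - klein_orbit x r a. orbit_type x r b = T} =
    {b \<in> A. orbit_type x r b = T} - klein_orbit x r a" by blast
  moreover have "klein_orbit x r a \<subseteq> {b \<in> A. orbit_type x r b = T}"
    using orbit_type_klein_orbit[OF c a] klein_orbit_subset[OF c a] True by blast
  ultimately show ?thesis using True by (simp add: card_Diff_subset)
next
  case False
  then have "b \<notin> klein_orbit x r a" if "orbit_type x r b = T" for b
    using orbit_type_klein_orbit[OF c a] that by metis
  then have "{b \<in> A - klein_orbit x r a. orbit_type x r b = T} = {b \<in> A. orbit_type x r b = T}"
    by blast
  then show ?thesis using False by simp
qed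

text \<open>Remove an orbit from \<open>A\<close> and one of the same type from \<open>A'\<close>.
  The counts stay equal, the complements are closed under the actions, and the bijection of the two
  orbits glues with the one obtained by induction.\<close>

lemma equivariant_bij_types:
  assumes "finite A" "klein_action A x r" "finite A'" "klein_action A' x' r'"
    and "\<And>T. card {a \<in> A. orbit_type x r a = T} = card {a \<in> A'. orbit_type x' r' a = T}"
  shows "\<exists>g. bij_betw g A A' \<and> (\<forall>a\<in>A. g (x a) = x' (g a) \<and> g (r a) = r' (g a))"
  using assms
proof (induction "card A" arbitrary: A A' rule: less_induct)
  case less
  note fin = less.prems(1,3) and c = less.prems(2) and c' = less.prems(4) and ty = less.prems(5)
  show ?case
  proof (cases "A = {}")
    case True
    have "A' = {}"
    proof (rule ccontr)
      assume "A' \<noteq> {}"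
      then obtain a' where "a' \<in> A'" by blast
      then have "card {a \<in> A'. orbit_type x' r' a = orbit_type x' r' a'} \<noteq> 0"
        using fin by auto
      then show False unfolding ty[symmetric] True by simp
    qed
    then show ?thesis using True by (auto simp: bij_betw_def)
  next
    case False
    then obtain a where a: "a \<in> A" by blast
    then have "card {b \<in> A. orbit_type x r b = orbit_type x r a} \<noteq> 0"
      using fin by auto
    then have "card {b \<in> A'. orbit_type x' r' b = orbit_type x r a} \<noteq> 0"
      unfolding ty .
    then have "{b \<in> A'. orbit_type x' r' b = orbit_type x r a} \<noteq> {}"
      by (intro notI) simp
    then obtain a' where "a' \<in> {b \<in> A'. orbit_type x' r' b = orbit_type x r a}"
      by blast
    then have a': "a' \<in> A'" "orbit_type x r a = orbit_type x' r' a'"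
      by simp_all
    let ?O = "klein_orbit x r a" and ?O' = "klein_orbit x' r' a'"
    obtain h where h: "bij_betw h ?O ?O'"
      "\<And>b. b \<in> ?O \<Longrightarrow> h (x b) = x' (h b) \<and> h (r b) = r' (h b)"
      using klein_orbit_bij[OF c a c' a'] by blast
    have "a \<in> ?O" by (simp add: klein_orbit_def)
    then have less_card: "card (A - ?O) < card A"
      using fin a by (intro psubset_card_mono) auto
    have "card {b \<in> A - ?O. orbit_type x r b = T} = card {b \<in> A' - ?O'. orbit_type x' r' b = T}" for T
      unfolding card_type_Diff_klein_orbit[OF fin(1) c a] card_type_Diff_klein_orbit[OF fin(2) c' a'(1)] ty a'(2)
      using bij_betw_same_card[OF h(1)] by simp
    then obtain g where g: "bij_betw g (A - ?O) (A' - ?O')"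
      "\<And>b. b \<in> A - ?O \<Longrightarrow> g (x b) = x' (g b) \<and> g (r b) = r' (g b)"
      using less.hyps[OF less_card _ klein_action_Diff_klein_orbit[OF c a] _
          klein_action_Diff_klein_orbit[OF c' a'(1)]] fin by blast
    define m where "m = (\<lambda>b. if b \<in> ?O then h b else g b)"
    have "bij_betw m ?O ?O'"
      using h(1) by (rule bij_betw_cong[THEN iffD1, rotated]) (simp add: m_def)
    moreover have "bij_betw m (A - ?O) (A' - ?O')"
      using g(1) by (rule bij_betw_cong[THEN iffD1, rotated]) (simp add: m_def)
    ultimately have "bij_betw m (?O \<union> (A - ?O)) (?O' \<union> (A' - ?O'))"
      by (rule bij_betw_combine) blast
    then have "bij_betw m A A'"
      using klein_orbit_subset[OF c a] klein_orbit_subset[OF c' a'(1)] by (simp add: Un_absorb1)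
    moreover have "m (x b) = x' (m b) \<and> m (r b) = r' (m b)" if b: "b \<in> A" for b
    proof (cases "b \<in> ?O")
      case True
      then show ?thesis using h(2) klein_orbit_closed[OF c a] by (simp add: m_def)
    next
      case False
      then have "x b \<notin> ?O" "r b \<notin> ?O"
        using klein_action_Diff_klein_orbit[OF c a] b unfolding klein_action_def by blast+
      then show ?thesis using g(2) b False by (simp add: m_def)
    qed
    ultimately show ?thesis by blast
  qed
qed

text \<open>The size and the two counts determine the count of every type:
  \<open>(True, True)\<close> does not occur, and the regular points are what is left.\<close>

lemma equivariant_bij:
  assumes fin: "finite A" "finite A'"
    and c: "klein_action A x r" "klein_action A' x' r'"
    and cards: "card A = card A'" "card {a \<in> A. x a = a} = card {a \<in> A'. x' a = a}"
      "card {a \<in> A. x a = r a} = card {a \<in> A'. x' a = r' a}"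
  shows "\<exists>g. bij_betw g A A' \<and> (\<forall>a\<in>A. g (x a) = x' (g a) \<and> g (r a) = r' (g a))"
proof (rule equivariant_bij_types[OF fin(1) c(1) fin(2) c(2)])
  have types: "card {a \<in> A. orbit_type x r a = T} =
      (if T = (True, False) then card {a \<in> A. x a = a}
       else if T = (False, True) then card {a \<in> A. x a = r a}
       else if T = (True, True) then 0
       else card A - card {a \<in> A. x a = a} - card {a \<in> A. x a = r a})"
    if fin: "finite A" and c: "klein_action A x r"
    for A :: "'x set" and x r T
  proof -
    have ne: "r a \<noteq> a" if "a \<in> A" for a
      using c that unfolding klein_action_def by blast
    have T: "orbit_type x r a = T \<longleftrightarrow> (if T = (True, False) then x a = a
        else if T = (False, True) then x a = r a
        else if T = (True, True) then False else x a \<noteq> a \<and> x a \<noteq> r a)" if "a \<in> A" for a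
      using ne[OF that] by (cases T) (auto simp: orbit_type_def)
    have "{a \<in> A. orbit_type x r a = T} = (if T = (True, False) then {a \<in> A. x a = a}
        else if T = (False, True) then {a \<in> A. x a = r a}
        else if T = (True, True) then {} else A - {a \<in> A. x a = a} - {a \<in> A. x a = r a})"
      (is "_ = ?B")
    proof (rule Set.set_eqI)
      fix b show "b \<in> {a \<in> A. orbit_type x r a = T} \<longleftrightarrow> b \<in> ?B"
        by (cases "b \<in> A") (simp_all add: T)
    qed
    moreover have "card (A - {a \<in> A. x a = a} - {a \<in> A. x a = r a}) =
        card A - card {a \<in> A. x a = a} - card {a \<in> A. x a = r a}"
    proof -
      have "{a \<in> A. x a = r a} \<subseteq> A - {a \<in> A. x a = a}"
        using ne by fastforce
      then show ?thesis using fin by (simp add: card_Diff_subset)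
    qed
    ultimately show ?thesis by (simp only: if_distrib[of card] card.empty)
  qed
  show "card {a \<in> A. orbit_type x r a = T} = card {a \<in> A'. orbit_type x' r' a = T}" for T
    unfolding types[OF fin(1) c(1)] types[OF fin(2) c(2)] cards ..
qed

section \<open>Involutions commuting with the reversal\<close>

definition reversal :: "nat \<Rightarrow> nat \<Rightarrow> nat" where
  "reversal N a = (if a \<in> {1..N} then Suc N - a else a)"

definition sym_involutions :: "nat \<Rightarrow> (nat \<Rightarrow> nat) set" where
  "sym_involutions N =
     {p. p permutes {1..N} \<and> p \<circ> p = id \<and> p \<circ> reversal N = reversal N \<circ> p}"

lemma reversal_permutes: "reversal N permutes {1..N}"
  by (rule bij_imp_permutes, rule bij_betw_byWitness[where f' = "reversal N"])
    (auto simp: reversal_def)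

lemma reversal_reversal [simp]: "reversal N (reversal N a) = a"
  by (auto simp: reversal_def)

lemma sym_involutions_klein_action:
  assumes "p \<in> sym_involutions (2 * n)"
  shows "klein_action {1..2 * n} p (reversal (2 * n))"
proof -
  have "p permutes {1..2 * n}" "\<And>a. p (p a) = a"
    "\<And>a. p (reversal (2 * n) a) = reversal (2 * n) (p a)"
    using assms unfolding sym_involutions_def by (auto simp: fun_eq_iff)
  \<comment> \<open>A fixed point would satisfy \<open>2 * a = 2 * n + 1\<close>. The reversal is
    free because the number of points is even.\<close>
  moreover have "reversal (2 * n) a \<noteq> a" if "a \<in> {1..2 * n}" for a
    using that by (simp add: reversal_def) presburger
  ultimately show ?thesis
    using permutes_in_image permutes_in_image[OF reversal_permutes]
    unfolding klein_action_def by (metis reversal_reversal)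
qed

definition fixed_count :: "nat \<Rightarrow> (nat \<Rightarrow> nat) \<Rightarrow> nat" where
  "fixed_count N p = card {a \<in> {1..N}. p a = a}"

definition reversed_count :: "nat \<Rightarrow> (nat \<Rightarrow> nat) \<Rightarrow> nat" where
  "reversed_count N p = card {a \<in> {1..N}. p a = reversal N a}"

text \<open>Such a \<open>g\<close> is an isomorphism from the Klein action of \<open>q\<close> and
  the reversal to that of \<open>p\<close> and the reversal, so it transports both counts;
  conversely equal counts allow \<open>equivariant_bij\<close>.\<close>

lemma sym_involutions_conjugate_iff:
  assumes p: "p \<in> sym_involutions (2 * n)" and q: "q \<in> sym_involutions (2 * n)"
  shows "(\<exists>g. g permutes {1..2 * n} \<and> g \<circ> reversal (2 * n) = reversal (2 * n) \<circ> g \<and> g \<circ> q = p \<circ> g) \<longleftrightarrow>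
    fixed_count (2 * n) p = fixed_count (2 * n) q \<and>
    reversed_count (2 * n) p = reversed_count (2 * n) q"
    (is "?L \<longleftrightarrow> ?R")
proof
  let ?S = "{1..2 * n}" and ?r = "reversal (2 * n)"
  assume ?L
  then obtain g where g: "g permutes ?S" "\<And>a. g (?r a) = ?r (g a)" "\<And>a. g (q a) = p (g a)"
    by (auto simp: fun_eq_iff)
  have inj: "g a = g b \<longleftrightarrow> a = b" for a b using permutes_inj[OF g(1)] by (simp add: inj_eq)
  have transport: "card {a \<in> ?S. Q a} = card {a \<in> ?S. P a}" if "\<And>a. Q a \<longleftrightarrow> P (g a)" for P Q
  proof -
    have "bij_betw g {a \<in> ?S. Q a} {a \<in> ?S. P a}"
      unfolding bij_betw_def
    proof
      show "inj_on g {a \<in> ?S. Q a}" using inj by (simp add: inj_on_def)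
      show "g ` {a \<in> ?S. Q a} = {a \<in> ?S. P a}"
      proof (intro equalityI subsetI)
        fix b assume "b \<in> g ` {a \<in> ?S. Q a}"
        then show "b \<in> {a \<in> ?S. P a}" using that permutes_in_image[OF g(1)] by auto
      next
        fix b assume b: "b \<in> {a \<in> ?S. P a}"
        obtain a where a: "g a = b" using permutes_surj[OF g(1)] by (metis surj_def)
        then have "a \<in> ?S" using b permutes_in_image[OF g(1)] by blast
        then show "b \<in> g ` {a \<in> ?S. Q a}" using that a b by auto
      qed
    qed
    then show ?thesis by (rule bij_betw_same_card)
  qed
  have "fixed_count (2 * n) q = fixed_count (2 * n) p"
    unfolding fixed_count_def by (rule transport) (metis g(3) inj)
  moreover have "reversed_count (2 * n) q = reversed_count (2 * n) p"
    unfolding reversed_count_def by (rule transport) (metis g(2,3) inj)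
  ultimately show ?R by simp
next
  let ?S = "{1..2 * n}" and ?r = "reversal (2 * n)"
  assume ?R
  then obtain g where g: "bij_betw g ?S ?S" "\<And>a. a \<in> ?S \<Longrightarrow> g (q a) = p (g a) \<and> g (?r a) = ?r (g a)"
    using equivariant_bij[OF _ _ sym_involutions_klein_action[OF q] sym_involutions_klein_action[OF p]]
    unfolding fixed_count_def reversed_count_def by auto
  \<comment> \<open>\<open>g\<close> is controlled only on \<open>?S\<close>; a permutation of
    \<open>?S\<close> must also fix every other number.\<close>
  define h where "h = (\<lambda>a. if a \<in> ?S then g a else a)"
  have "bij_betw h ?S ?S"
    using g(1) by (rule bij_betw_cong[THEN iffD1, rotated]) (simp add: h_def)
  then have perm: "h permutes ?S"
    by (rule bij_imp_permutes) (auto simp: h_def)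
  have pq: "p permutes ?S" "q permutes ?S"
    using p q by (auto simp: sym_involutions_def)
  have "h (u a) = v (h a)" if "u permutes ?S" "v permutes ?S" "\<And>a. a \<in> ?S \<Longrightarrow> g (u a) = v (g a)" for u v a
  proof (cases "a \<in> ?S")
    case True
    then have "u a \<in> ?S" using permutes_in_image that(1) by metis
    then show ?thesis unfolding h_def using True that(3) by (simp only: if_True)
  next
    case False
    then have "u a = a" "v a = a" "h a = a" using that permutes_not_in unfolding h_def by metis+
    then show ?thesis by simp
  qed
  then have "h \<circ> q = p \<circ> h" "h \<circ> ?r = ?r \<circ> h"
    using pq reversal_permutes g(2) by (simp_all only: fun_eq_iff comp_apply, blast+)
  then show ?L using perm by blast
qed

section \<open>The elements \<open>c\<^sub>k\<^sub>l\<close> as permutations\<close>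

lemma reversal_block_perms: "reversal N \<in> block_perms N {1..<N}"
  using reversal_permutes by (simp add: block_perms_full del: One_nat_def)

lemma reversal_Suc_less: "j \<in> {1..<N} \<Longrightarrow> reversal N (Suc j) < reversal N j"
  by (auto simp: reversal_def)

lemma nodes_kl_iff:
  assumes "l + 2 * k \<le> n"
  shows "j \<in> nodes_kl n k l \<longleftrightarrow>
    odd j \<and> (j < 2 * k \<or> 2 * n - 2 * k < j \<and> j < 2 * n) \<or> n - l < j \<and> j < n + l"
proof -
  have "(\<exists>i. j = 2 * i - 1 \<and> 1 \<le> i \<and> i \<le> k) \<longleftrightarrow> odd j \<and> j < 2 * k"
    by presburger
  moreover have "(\<exists>i. j = 2 * n + 1 - 2 * i \<and> 1 \<le> i \<and> i \<le> k) \<longleftrightarrow>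
      odd j \<and> 2 * n - 2 * k < j \<and> j < 2 * n"
  proof
    assume "\<exists>i. j = 2 * n + 1 - 2 * i \<and> 1 \<le> i \<and> i \<le> k"
    then show "odd j \<and> 2 * n - 2 * k < j \<and> j < 2 * n"
      using assms by auto
  next
    assume j: "odd j \<and> 2 * n - 2 * k < j \<and> j < 2 * n"
    then obtain m where m: "j = 2 * m + 1" by (metis oddE)
    show "\<exists>i. j = 2 * n + 1 - 2 * i \<and> 1 \<le> i \<and> i \<le> k"
      using j m assms by (intro exI[of _ "n - m"]) auto
  qed
  ultimately show ?thesis
    unfolding nodes_kl_def by auto
qed

text \<open>The middle nodes join the \<open>2 * l\<close> points from \<open>n - l + 1\<close> to
  \<open>n + l\<close> into one block, and each other node joins just its two end points. Every
  block is reversed.\<close>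

definition perm_kl :: "nat \<Rightarrow> nat \<Rightarrow> nat \<Rightarrow> nat \<Rightarrow> nat" where
  "perm_kl n k l a =
     (if n - l < a \<and> a \<le> n + l then 2 * n + 1 - a
      else if 1 \<le> a \<and> a \<le> 2 * k \<or> 2 * n - 2 * k < a \<and> a \<le> 2 * n
        then (if odd a then a + 1 else a - 1)
      else a)"

definition paired_node :: "nat \<Rightarrow> nat \<Rightarrow> nat \<Rightarrow> bool" where
  "paired_node n k j \<longleftrightarrow> odd j \<and> (j < 2 * k \<or> 2 * n - 2 * k < j \<and> j < 2 * n)"

context
  fixes n k l :: nat
  assumes le: "l + 2 * k \<le> n"
begin

text \<open>The last bound keeps both end points \<open>j\<close> and \<open>Suc j\<close> outside
  the middle block; on the lower side this uses that \<open>j\<close> is odd.\<close>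

lemma paired_node_bounds:
  assumes "paired_node n k j"
  shows "1 \<le> j" "j < 2 * n" "j < n - l \<or> n + l < j"
  using assms le odd_pos[of j] by (auto simp: paired_node_def)

lemma perm_kl_paired:
  assumes "paired_node n k j"
  shows "perm_kl n k l j = Suc j" "perm_kl n k l (Suc j) = j"
proof -
  have j: "odd j" "j < 2 * k \<or> 2 * n - 2 * k < j \<and> j < 2 * n"
    using assms by (auto simp: paired_node_def)
  note b = paired_node_bounds[OF assms]
  have "\<not> (n - l < j \<and> j \<le> n + l)" "\<not> (n - l < Suc j \<and> Suc j \<le> n + l)"
    using b by linarith+
  moreover have "1 \<le> j \<and> j \<le> 2 * k \<or> 2 * n - 2 * k < j \<and> j \<le> 2 * n"
    "1 \<le> Suc j \<and> Suc j \<le> 2 * k \<or> 2 * n - 2 * k < Suc j \<and> Suc j \<le> 2 * n"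
    using b j(2) by linarith+
  ultimately show "perm_kl n k l j = Suc j" "perm_kl n k l (Suc j) = j"
    using j(1) unfolding perm_kl_def by (simp_all only: if_True if_False) auto
qed

lemma perm_kl_middle: "n - l < a \<Longrightarrow> a \<le> n + l \<Longrightarrow> perm_kl n k l a = 2 * n + 1 - a"
  by (simp add: perm_kl_def)

lemma perm_kl_fixed:
  assumes "a = 0 \<or> 2 * k < a \<and> a \<le> n - l \<or> n + l < a \<and> a \<le> 2 * n - 2 * k \<or> 2 * n < a"
  shows "perm_kl n k l a = a"
proof -
  have "\<not> (n - l < a \<and> a \<le> n + l)"
    "\<not> (1 \<le> a \<and> a \<le> 2 * k \<or> 2 * n - 2 * k < a \<and> a \<le> 2 * n)"
    using assms le by linarith+
  then show ?thesis unfolding perm_kl_def by (simp only: if_False)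
qed

lemma perm_kl_cases:
  obtains (middle) "n - l < a" "a \<le> n + l"
  | (lower) "paired_node n k a"
  | (upper) j where "a = Suc j" "paired_node n k j"
  | (fixed) "a = 0 \<or> 2 * k < a \<and> a \<le> n - l \<or> n + l < a \<and> a \<le> 2 * n - 2 * k \<or> 2 * n < a"
proof -
  consider "n - l < a" "a \<le> n + l" | "1 \<le> a" "a \<le> 2 * k \<or> 2 * n - 2 * k < a \<and> a \<le> 2 * n"
    | "a = 0 \<or> 2 * k < a \<and> a \<le> n - l \<or> n + l < a \<and> a \<le> 2 * n - 2 * k \<or> 2 * n < a"
    by linarith
  then show thesis
  proof cases
    case 2
    show thesis
    proof (cases "odd a")
      case True
      then have "a \<noteq> 2 * k" "a \<noteq> 2 * n" by auto
      then show thesis using True 2 lower by (auto simp: paired_node_def)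
    next
      case False
      then obtain j where j: "a = Suc j" "odd j" using 2 by (cases a) auto
      \<comment> \<open>The bound on \<open>a\<close> gives only \<open>2 * n - 2 * k <= j\<close>;
        parity makes it strict.\<close>
      then have "j \<noteq> 2 * n - 2 * k" by auto
      then show thesis using 2 j upper[of j] by (auto simp: paired_node_def)
    qed
  qed (use middle fixed in blast)+
qed

lemma perm_kl_perm_kl: "perm_kl n k l (perm_kl n k l a) = a"
proof (cases rule: perm_kl_cases[of a])
  case middle
  moreover have "n - l < 2 * n + 1 - a" "2 * n + 1 - a \<le> n + l" "a \<le> 2 * n"
    using middle le by linarith+
  ultimately show ?thesis by (simp add: perm_kl_middle)
next
  case fixed
  then show ?thesis by (simp only: perm_kl_fixed)
qed (simp_all add: perm_kl_paired)

lemma perm_kl_permutes: "perm_kl n k l permutes {1..2 * n}"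
proof -
  have "perm_kl n k l a = a" if "a \<notin> {1..2 * n}" for a
    by (rule perm_kl_fixed) (use that in auto)
  then show ?thesis
    unfolding permutes_def by (metis perm_kl_perm_kl)
qed

lemma perm_kl_reversal:
  "perm_kl n k l (reversal (2 * n) a) = reversal (2 * n) (perm_kl n k l a)"
proof -
  \<comment> \<open>The reversal sends the points \<open>j\<close> and \<open>Suc j\<close> to
    \<open>Suc (2 * n - j)\<close> and \<open>2 * n - j\<close>, so it carries node \<open>j\<close>
    to node \<open>2 * n - j\<close>.\<close>
  have paired: "paired_node n k (2 * n - j)" if "paired_node n k j" for j
    using that le odd_pos[of j] by (auto simp: paired_node_def)
  have rev: "reversal (2 * n) j = Suc (2 * n - j)" "reversal (2 * n) (Suc j) = 2 * n - j"
    if "paired_node n k j" for j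
    using paired_node_bounds[OF that] by (auto simp: reversal_def)
  show ?thesis
  proof (cases rule: perm_kl_cases[of a])
    case middle
    then have "reversal (2 * n) a = 2 * n + 1 - a" "n - l < 2 * n + 1 - a" "2 * n + 1 - a \<le> n + l"
      using le by (auto simp: reversal_def)
    then show ?thesis using middle by (simp add: perm_kl_middle) (metis reversal_reversal)
  next
    case fixed
    have "perm_kl n k l (reversal (2 * n) a) = reversal (2 * n) a"
      by (rule perm_kl_fixed) (use fixed le in \<open>auto simp: reversal_def\<close>)
    then show ?thesis using fixed by (simp only: perm_kl_fixed)
  qed (simp_all add: rev paired perm_kl_paired)
qed

lemma perm_kl_sym_involutions: "perm_kl n k l \<in> sym_involutions (2 * n)"
  using perm_kl_permutes perm_kl_perm_kl perm_kl_reversal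
  by (auto simp: sym_involutions_def fun_eq_iff)

lemma nodes_kl_subset: "nodes_kl n k l \<subseteq> {1..<2 * n}"
proof
  fix j assume "j \<in> nodes_kl n k l"
  then show "j \<in> {1..<2 * n}"
    unfolding nodes_kl_iff[OF le] using le odd_pos[of j] by auto
qed

lemma nodes_kl_paired: "j \<in> nodes_kl n k l \<longleftrightarrow> paired_node n k j \<or> n - l < j \<and> j < n + l"
  unfolding nodes_kl_iff[OF le] paired_node_def by blast

lemma perm_kl_block_perms: "perm_kl n k l \<in> block_perms (2 * n) (nodes_kl n k l)"
proof -
  have single: "{j..<Suc j} = {j}" for j by auto
  have "same_block (nodes_kl n k l) (perm_kl n k l a) a" for a
  proof (cases rule: perm_kl_cases[of a])
    case middle
    have "{min (2 * n + 1 - a) a..<max (2 * n + 1 - a) a} \<subseteq> {j. n - l < j \<and> j < n + l}"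
      using middle le by auto
    then show ?thesis
      unfolding same_block_def perm_kl_middle[OF middle] using nodes_kl_paired by blast
  next
    case fixed
    then show ?thesis by (simp only: perm_kl_fixed same_block_refl)
  qed (simp_all add: perm_kl_paired same_block_def single nodes_kl_paired)
  then show ?thesis using perm_kl_permutes by (simp add: block_perms_def)
qed

lemma perm_kl_descent:
  assumes "j \<in> nodes_kl n k l" shows "perm_kl n k l (Suc j) < perm_kl n k l j"
  using assms le unfolding nodes_kl_paired
  by (elim disjE) (auto simp: perm_kl_paired perm_kl_middle)

text \<open>The fixed points fill the two gaps between the outer pairs and the middle block, with
  \<open>n - l - 2 * k\<close> points in each.\<close>

lemma fixed_count_perm_kl: "fixed_count (2 * n) (perm_kl n k l) = 2 * (n - l - 2 * k)"
proof -
  have "{a \<in> {1..2 * n}. perm_kl n k l a = a} = {2 * k<..n - l} \<union> {n + l<..2 * n - 2 * k}"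
  proof (rule Set.set_eqI)
    fix a
    show "a \<in> {a \<in> {1..2 * n}. perm_kl n k l a = a} \<longleftrightarrow> a \<in> {2 * k<..n - l} \<union> {n + l<..2 * n - 2 * k}"
    proof (cases rule: perm_kl_cases[of a])
      case middle
      then have "2 * n + 1 - a \<noteq> a" by presburger
      then show ?thesis using middle by (simp add: perm_kl_middle)
    next
      case lower
      then show ?thesis by (auto simp: perm_kl_paired) (auto simp: paired_node_def)
    next
      case (upper j)
      then have "odd j" "j < 2 * k \<or> 2 * n - 2 * k < j" by (auto simp: paired_node_def)
      then show ?thesis using upper by (auto simp: perm_kl_paired)
    next
      case fixed
      then have "perm_kl n k l a = a" by (rule perm_kl_fixed)
      then show ?thesis using fixed le by auto
    qed
  qed
  moreover have "card ({2 * k<..n - l} \<union> {n + l<..2 * n - 2 * k}) =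
      card {2 * k<..n - l} + card {n + l<..2 * n - 2 * k}"
    using le by (intro card_Un_disjoint) auto
  ultimately show ?thesis using le by (simp add: fixed_count_def)
qed

lemma reversed_count_perm_kl: "reversed_count (2 * n) (perm_kl n k l) = 2 * l"
proof -
  have "{a \<in> {1..2 * n}. perm_kl n k l a = reversal (2 * n) a} = {n - l<..n + l}"
  proof (rule Set.set_eqI)
    fix a
    \<comment> \<open>On the pair of node \<open>j\<close>, agreement with the reversal would force
      \<open>j = n\<close>, but paired nodes lie strictly below or strictly above
      \<open>n\<close>.\<close>
    have odd: "odd j" "j \<noteq> n" if "paired_node n k j" for j
      using that le by (auto simp: paired_node_def)
    show "a \<in> {a \<in> {1..2 * n}. perm_kl n k l a = reversal (2 * n) a} \<longleftrightarrow> a \<in> {n - l<..n + l}"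
    proof (cases rule: perm_kl_cases[of a])
      case middle
      then show ?thesis using le by (simp add: reversal_def perm_kl_middle)
    next
      case lower
      then show ?thesis using odd[OF lower] paired_node_bounds[OF lower]
        by (auto simp: reversal_def perm_kl_paired)
    next
      case (upper j)
      then show ?thesis using odd[OF upper(2)] paired_node_bounds[OF upper(2)]
        by (auto simp: reversal_def perm_kl_paired)
    next
      case fixed
      have "a \<noteq> 2 * n + 1 - a" if "a \<le> 2 * n" using that by presburger
      then show ?thesis using fixed le perm_kl_fixed[OF fixed] by (auto simp: reversal_def)
    qed
  qed
  then show ?thesis using le by (simp add: reversed_count_def)
qed

end

text \<open>Solving \<open>2 * n = 2 * f + 2 * l + 4 * k\<close> for \<open>f\<close> shows that
  every such involution has the counts of some \<open>perm_kl n k l\<close>.\<close>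

lemma sym_involutions_counts:
  assumes "p \<in> sym_involutions (2 * n)"
  obtains k l where "l + 2 * k \<le> n" "fixed_count (2 * n) p = 2 * (n - l - 2 * k)"
    "reversed_count (2 * n) p = 2 * l"
proof -
  obtain f l k where "fixed_count (2 * n) p = 2 * f" "reversed_count (2 * n) p = 2 * l"
    and "card {1..2 * n} = 2 * f + 2 * l + 4 * k"
    using card_type_classes[OF _ sym_involutions_klein_action[OF assms]]
    unfolding fixed_count_def reversed_count_def by blast
  moreover from this have "f = n - l - 2 * k" "l + 2 * k \<le> n" by simp_all
  ultimately show thesis using that by blast
qed

text \<open>With \<open>r\<close> for the reversal, \<open>p (r a) = a\<close> means
  \<open>p a = r a\<close>, and \<open>p (r a) = r a\<close> means \<open>p a = a\<close>, because
  \<open>r\<close> is self-inverse and commutes with \<open>p\<close>.\<close>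

lemma sym_involutions_mult_reversal:
  assumes p: "p \<in> sym_involutions (2 * n)"
  shows "p \<circ> reversal (2 * n) \<in> sym_involutions (2 * n)"
    and "fixed_count (2 * n) (p \<circ> reversal (2 * n)) = reversed_count (2 * n) p"
    and "reversed_count (2 * n) (p \<circ> reversal (2 * n)) = fixed_count (2 * n) p"
proof -
  let ?r = "reversal (2 * n)"
  have perm: "p permutes {1..2 * n}" and pp: "\<And>a. p (p a) = a" and pr: "\<And>a. p (?r a) = ?r (p a)"
    using p by (auto simp: sym_involutions_def fun_eq_iff)
  show "p \<circ> ?r \<in> sym_involutions (2 * n)"
    unfolding sym_involutions_def
    using permutes_compose[OF reversal_permutes perm] by (auto simp: fun_eq_iff pp pr)
  have "(p \<circ> ?r) a = a \<longleftrightarrow> p a = ?r a" "(p \<circ> ?r) a = ?r a \<longleftrightarrow> p a = a" for a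
    unfolding comp_apply pr by (metis reversal_reversal)+
  then show "fixed_count (2 * n) (p \<circ> ?r) = reversed_count (2 * n) p"
    "reversed_count (2 * n) (p \<circ> ?r) = fixed_count (2 * n) p"
    unfolding fixed_count_def reversed_count_def by simp_all
qed

section \<open>Translation from permutations back to the Coxeter group\<close>

context coxeter_type_A
begin

definition w0 :: 'a where "w0 = perm_val (reversal N)"

lemma longest_element_full: "longest_element W s {1..<N} = w0"
  unfolding w0_def
  by (rule longest_element_eq[OF order_refl reversal_block_perms reversal_Suc_less])

lemma commuting_with_w0:
  "commuting_with W w0 =
    perm_val ` {p. p permutes {1..N} \<and> p \<circ> reversal N = reversal N \<circ> p}"
proof -
  have "perm_val p \<otimes> w0 = w0 \<otimes> perm_val p \<longleftrightarrow> p \<circ> reversal N = reversal N \<circ> p"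
    if "p permutes {1..N}" for p
    using that reversal_permutes unfolding w0_def
    by (subst (1 2) perm_val_mult) (auto simp: perm_val_eq_iff permutes_compose)
  then show ?thesis
    unfolding commuting_with_def carrier_eq by auto
qed

lemma involutions_commuting_with_w0:
  "involutions W \<inter> commuting_with W w0 = perm_val ` sym_involutions N"
proof -
  have inv: "perm_val p \<otimes> perm_val p = \<one> \<longleftrightarrow> p \<circ> p = id" if "p permutes {1..N}" for p
    using that perm_val_eq_iff[OF permutes_compose[OF that that] permutes_id]
    by (simp add: perm_val_mult perm_val_id)
  show ?thesis
  proof (intro equalityI subsetI)
    fix x assume "x \<in> involutions W \<inter> commuting_with W w0"
    then obtain p where "p permutes {1..N}" "p \<circ> reversal N = reversal N \<circ> p" "x = perm_val p"
      "x \<otimes> x = \<one>"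
      unfolding commuting_with_w0 involutions_def by blast
    then show "x \<in> perm_val ` sym_involutions N"
      using inv unfolding sym_involutions_def by blast
  next
    fix x assume "x \<in> perm_val ` sym_involutions N"
    then obtain p where "p \<in> sym_involutions N" "x = perm_val p" by blast
    then show "x \<in> involutions W \<inter> commuting_with W w0"
      using inv perm_val_closed unfolding commuting_with_w0 involutions_def sym_involutions_def by blast
  qed
qed

text \<open>Clearing the inverse gives an equality of two products, and \<open>perm_val\<close>
  reverses both; hence \<open>q\<close> stands on the right of \<open>g\<close> and \<open>p\<close>
  on the left.\<close>

lemma conjugate_in_perm_val:
  assumes p: "p permutes {1..N}" and q: "q permutes {1..N}"
  shows "conjugate_in W (commuting_with W w0) (perm_val p) (perm_val q) \<longleftrightarrow>
    (\<exists>g. g permutes {1..N} \<and> g \<circ> reversal N = reversal N \<circ> g \<and> g \<circ> q = p \<circ> g)"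
proof -
  have "perm_val q = perm_val g \<otimes> perm_val p \<otimes> inv (perm_val g) \<longleftrightarrow> g \<circ> q = p \<circ> g"
    if g: "g permutes {1..N}" for g
  proof -
    have "perm_val q = perm_val g \<otimes> perm_val p \<otimes> inv (perm_val g) \<longleftrightarrow>
        perm_val q \<otimes> perm_val g = perm_val g \<otimes> perm_val p"
      using perm_val_closed p q g by (metis inv_solve_right m_closed)
    then show ?thesis
      using p q g by (simp add: perm_val_mult perm_val_eq_iff permutes_compose)
  qed
  then show ?thesis unfolding conjugate_in_def commuting_with_w0 by auto
qed

end

lemma kl_pairs_iff: "(k, l) \<in> kl_pairs n \<longleftrightarrow> l + 2 * k \<le> n"
  unfolding kl_pairs_def by auto

theorem mainTheorem2:
  fixes W :: "('a, 'b) monoid_scheme" and s :: "nat \<Rightarrow> 'a" and n :: nat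
    and w\<^sub>o :: 'a and W\<^sub>o :: "'a set" and c :: "nat \<Rightarrow> nat \<Rightarrow> 'a"
  assumes "n \<ge> 2"
    and "coxeter_system W {1..2 * n - 1} type_A_matrix s"
  defines "w\<^sub>o \<equiv> longest_element W s {1..2 * n - 1}"
    and "W\<^sub>o \<equiv> commuting_with W w\<^sub>o"
    and "c \<equiv> \<lambda>k l. longest_element W s (nodes_kl n k l)"
  shows "(\<forall>(k, l)\<in>kl_pairs n. c k l \<in> involutions W \<inter> W\<^sub>o)
    \<and> (\<forall>x\<in>involutions W \<inter> W\<^sub>o.
         \<exists>!kl. kl \<in> kl_pairs n \<and> conjugate_in W W\<^sub>o x (c (fst kl) (snd kl)))
    \<and> (\<forall>(k, l)\<in>kl_pairs n.
         conjugate_in W W\<^sub>o (w\<^sub>o \<otimes>\<^bsub>W\<^esub> c k l) (c k (n - 2 * k - l)))"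
proof -
  have nodes: "{1..2 * n - 1} = {1..<2 * n}" by auto
  interpret coxeter_type_A W "2 * n" s
    using assms(2) unfolding nodes by (rule coxeter_type_A.intro)
  have wo: "w\<^sub>o = w0" and Wo: "W\<^sub>o = commuting_with W w0"
    unfolding w\<^sub>o_def W\<^sub>o_def nodes longest_element_full by simp_all
  have c: "c k l = perm_val (perm_kl n k l)" if "(k, l) \<in> kl_pairs n" for k l
  proof -
    have le: "l + 2 * k \<le> n" using that by (simp add: kl_pairs_iff)
    show ?thesis unfolding c_def
      by (rule longest_element_eq[OF nodes_kl_subset[OF le] perm_kl_block_perms[OF le]
            perm_kl_descent[OF le]])
  qed
  have sym_kl: "perm_kl n k l \<in> sym_involutions (2 * n)" if "(k, l) \<in> kl_pairs n" for k l
    using that perm_kl_sym_involutions by (simp add: kl_pairs_iff)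
  have conj: "conjugate_in W W\<^sub>o (perm_val p) (c k l) \<longleftrightarrow>
      fixed_count (2 * n) p = 2 * (n - l - 2 * k) \<and> reversed_count (2 * n) p = 2 * l"
    if p: "p \<in> sym_involutions (2 * n)" and kl: "(k, l) \<in> kl_pairs n" for p k l
  proof -
    have "p permutes {1..2 * n}" "perm_kl n k l permutes {1..2 * n}"
      using p sym_kl[OF kl] by (auto simp: sym_involutions_def)
    then have "conjugate_in W W\<^sub>o (perm_val p) (c k l) \<longleftrightarrow>
        fixed_count (2 * n) p = fixed_count (2 * n) (perm_kl n k l) \<and>
        reversed_count (2 * n) p = reversed_count (2 * n) (perm_kl n k l)"
      unfolding Wo c[OF kl] by (simp only: conjugate_in_perm_val sym_involutions_conjugate_iff[OF p sym_kl[OF kl]])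
    then show ?thesis
      using kl by (simp add: kl_pairs_iff fixed_count_perm_kl reversed_count_perm_kl)
  qed
  show ?thesis
  proof (intro conjI ballI)
    fix kl assume "kl \<in> kl_pairs n"
    then show "case kl of (k, l) \<Rightarrow> c k l \<in> involutions W \<inter> W\<^sub>o"
      unfolding Wo involutions_commuting_with_w0 using c sym_kl by (cases kl) auto
  next
    fix x assume "x \<in> involutions W \<inter> W\<^sub>o"
    then obtain p where p: "p \<in> sym_involutions (2 * n)" "x = perm_val p"
      unfolding Wo involutions_commuting_with_w0 by blast
    obtain k l where kl: "l + 2 * k \<le> n" "fixed_count (2 * n) p = 2 * (n - l - 2 * k)"
      "reversed_count (2 * n) p = 2 * l"
      using sym_involutions_counts[OF p(1)] by blast
    show "\<exists>!kl. kl \<in> kl_pairs n \<and> conjugate_in W W\<^sub>o x (c (fst kl) (snd kl))"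
    proof (rule ex1I[of _ "(k, l)"])
      show "(k, l) \<in> kl_pairs n \<and> conjugate_in W W\<^sub>o x (c (fst (k, l)) (snd (k, l)))"
        using kl conj[OF p(1), of k l] p(2) by (simp add: kl_pairs_iff)
    next
      fix kl' assume kl': "kl' \<in> kl_pairs n \<and> conjugate_in W W\<^sub>o x (c (fst kl') (snd kl'))"
      obtain k' l' where eq: "kl' = (k', l')" by fastforce
      then have "l' + 2 * k' \<le> n" "fixed_count (2 * n) p = 2 * (n - l' - 2 * k')"
          "reversed_count (2 * n) p = 2 * l'"
        using kl' conj[OF p(1), of k' l'] p(2) by (auto simp: kl_pairs_iff)
      \<comment> \<open>The reversed counts give \<open>l' = l\<close>; then the fixed counts give
        \<open>k' = k\<close>, as no subtraction is truncated.\<close>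
      then show "kl' = (k, l)" using kl eq by simp
    qed
  next
    fix kl assume kl: "kl \<in> kl_pairs n"
    obtain k l where eq: "kl = (k, l)" by fastforce
    let ?p = "perm_kl n k l"
    have le: "l + 2 * k \<le> n" and kl': "(k, n - 2 * k - l) \<in> kl_pairs n"
      using kl eq by (simp_all add: kl_pairs_iff)
    have "w\<^sub>o \<otimes>\<^bsub>W\<^esub> c k l = perm_val (?p \<circ> reversal (2 * n))"
      using kl eq perm_val_mult[OF reversal_permutes perm_kl_permutes[OF le]]
      by (simp add: wo w0_def c)
    \<comment> \<open>After the exchange there are \<open>2 * l\<close> fixed and
      \<open>2 * (n - l - 2 * k)\<close> reversed points. For \<open>l' = n - 2 * k - l\<close>
      these are the counts of \<open>perm_kl n k l'\<close>, because
      \<open>n - l' - 2 * k = l\<close>.\<close>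
    moreover have "conjugate_in W W\<^sub>o (perm_val (?p \<circ> reversal (2 * n))) (c k (n - 2 * k - l))"
      unfolding conj[OF sym_involutions_mult_reversal(1)[OF perm_kl_sym_involutions[OF le]] kl']
        sym_involutions_mult_reversal(2,3)[OF perm_kl_sym_involutions[OF le]]
        fixed_count_perm_kl[OF le] reversed_count_perm_kl[OF le]
      using le by simp
    ultimately show "case kl of (k, l) \<Rightarrow>
        conjugate_in W W\<^sub>o (w\<^sub>o \<otimes>\<^bsub>W\<^esub> c k l) (c k (n - 2 * k - l))"
      by (simp add: eq)
  qed
qed

end
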